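(* Let $t\ge 3$ be an integer, $\varepsilon<1$ any constant, $C$ a sufficiently large constant, and $Cn^{-1/4}(\ln n)^{9/4}\le p<\varepsilon$. Then with high probability \[\tau_t(G_{n,p})=(t+o(1))\,\chi(G_{n,p}).\]
   Context: A (proper) $t$-tone $k$-coloring of a graph $G$ is a function $f:V(G)\to\binom{[k]}{t}$ such that $|f(u)\cap f(v)|<d(u,v)$ for all distinct vertices $u,v$ ($d$ = graph distance); $\tau_t(G)$ is the least $k$ for which such a coloring exists. $\chi$ is the ordinary chromatic number. $G_{n,p}$ is the Erdős–Rényi random graph on $[n]$; "with high probability" means with probability $\to1$ as $n\to\infty$. *)

theory Defs
  imports "HOL-Probability.Probability" "HOL-Library.Extended_Nat"
begin

definition all_edges :: "nat \<Rightarrow> nat set set" where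
  "all_edges n = {e. e \<subseteq> {..<n} \<and> card e = 2}"

definition gnp :: "nat \<Rightarrow> real \<Rightarrow> nat set set pmf" where
  "gnp n p = map_pmf (\<lambda>b. {e \<in> all_edges n. b e})
                     (Pi_pmf (all_edges n) False (\<lambda>_. bernoulli_pmf p))"

fun has_walk :: "nat set set \<Rightarrow> nat \<Rightarrow> nat \<Rightarrow> nat \<Rightarrow> bool" where
  "has_walk E u v 0 = (u = v)"
| "has_walk E u v (Suc k) = (\<exists>w. {u, w} \<in> E \<and> has_walk E w v k)"

definition gdist :: "nat set set \<Rightarrow> nat \<Rightarrow> nat \<Rightarrow> enat" where
  "gdist E u v = (if \<exists>k. has_walk E u v k then enat (LEAST k. has_walk E u v k) else \<infinity>)"

definition tone_coloring :: "nat \<Rightarrow> nat set set \<Rightarrow> nat \<Rightarrow> nat \<Rightarrow> (nat \<Rightarrow> nat set) \<Rightarrow> bool" where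
  "tone_coloring n E t k f \<longleftrightarrow>
     (\<forall>v<n. f v \<subseteq> {1..k} \<and> card (f v) = t) \<and>
     (\<forall>u<n. \<forall>v<n. u \<noteq> v \<longrightarrow> enat (card (f u \<inter> f v)) < gdist E u v)"

definition tau :: "nat \<Rightarrow> nat \<Rightarrow> nat set set \<Rightarrow> nat" where
  "tau t n E = (LEAST k. \<exists>f. tone_coloring n E t k f)"

definition chi :: "nat \<Rightarrow> nat set set \<Rightarrow> nat" where
  "chi n E = (LEAST k. \<exists>c. (\<forall>v<n. c v < k) \<and>
                          (\<forall>u<n. \<forall>v<n. {u, v} \<in> E \<longrightarrow> c u \<noteq> c v))"

end

theory Submission
  imports Defs "HOL-Real_Asymp.Real_Asymp"
begin

text \<open>
  Every colour class of a tone colouring is independent, so both parameters are bounded below by the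
  independence number: \<open>\<tau>\<^sub>t \<ge> t n / \<alpha>\<close> and \<open>\<chi> \<ge> n / \<alpha>\<close>, and a first moment computation
  gives \<open>\<alpha> \<le> (2 + o(1)) log\<^sub>b (n p)\<close> with \<open>b = 1 / (1 - p)\<close>. For the matching upper bounds it
  suffices to find \<open>t\<close> proper colourings with \<open>(1 + o(1)) n / \<alpha>\<close> colours each such that two classes of
  different colourings share at most one vertex. They are built one after the other: as long as
  about \<open>n / log n\<close> vertices are uncoloured, remove an independent set of size \<open>(2 - o(1)) log\<^sub>b (n p)\<close>
  meeting each earlier class at most once; colour the remaining sparse part greedily.

  The earlier colourings depend on the graph, so such independent sets are needed simultaneously for
  all \<open>exp (O(n log n))\<close> possible families of earlier colourings. Janson's inequality gives the failure
  probability \<open>exp (- \<Omega>(n\<^sup>2 p\<^sup>4 / log\<^sup>6 n))\<close> for one family, which is small enough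
  because \<open>n p\<^sup>4 \<ge> log\<^sup>9 n\<close>.
\<close>

section \<open>Janson's inequality\<close>

text \<open>The exponent 1/4 has two sources. Write l = ln n, so that k and K are of order l/p, and
  let s be about n p / l^2. First, t earlier colourings with classes of size at most K spoil a
  fraction of at most k^2 t K / s of the candidate sets, which is of order l^5 / (n p^4). Second, in
  Janson's inequality overlaps in few vertices make \<Delta> / \<mu>^2 of order (k/s)^2, and the
  resulting exponent (s/k)^2 must exceed the t n l that counts the families of earlier colourings;
  this asks for n p^4 of order l^7. The available l^9 leaves a factor l^2 that absorbs every
  constant depending on t, \<epsilon> and the error \<eta>, so C may be any number from 1 on.
  Neither parameter is evaluated asymptotically: a single palette size M bounds chi by M and tau by
  t M, a single K bounds them below by n / K and t n / K, and everything rests on K M being at most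
  (1 + O(\<eta>)) n.\<close>

definition rsub :: "'a set \<Rightarrow> real \<Rightarrow> 'a set pmf" where
  "rsub E p = map_pmf (\<lambda>b. {e \<in> E. b e}) (Pi_pmf E False (\<lambda>_. bernoulli_pmf p))"

lemma gnp_eq_rsub: "gnp n p = rsub (all_edges n) p"
  by (simp add: gnp_def rsub_def)

lemma finite_all_edges [simp]: "finite (all_edges n)"
  unfolding all_edges_def by (rule finite_subset[of _ "Pow {..<n}"]) auto

abbreviation rexp :: "'a set \<Rightarrow> real \<Rightarrow> ('a set \<Rightarrow> real) \<Rightarrow> real" where
  "rexp E p g \<equiv> measure_pmf.expectation (rsub E p) g"

lemma set_rsub: "set_pmf (rsub E p) \<subseteq> Pow E"
  by (auto simp: rsub_def)

lemma finite_set_rsub: "finite E \<Longrightarrow> finite (set_pmf (rsub E p))"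
  using set_rsub finite_Pow_iff finite_subset by metis

lemma integrable_rsub [simp]:
  "finite E \<Longrightarrow> integrable (measure_pmf (rsub E p)) (g :: 'a set \<Rightarrow> real)"
  by (simp add: integrable_measure_pmf_finite finite_set_rsub)

lemma rexp_sum_pmf:
  "finite E \<Longrightarrow> rexp E p g = (\<Sum>R\<in>Pow E. g R * pmf (rsub E p) R)"
  using integral_measure_pmf[of "Pow E" "rsub E p" g] set_rsub[of E p] by (auto simp: mult.commute)

lemma rexp_mono:
  assumes "finite E" "\<And>G. G \<subseteq> E \<Longrightarrow> f G \<le> g G"
  shows "rexp E p f \<le> rexp E p g"
  unfolding rexp_sum_pmf[OF assms(1)] using assms(2) by (intro sum_mono mult_right_mono) auto

lemma rexp_cong:
  assumes "finite E" "\<And>G. G \<subseteq> E \<Longrightarrow> f G = g G"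
  shows "rexp E p f = rexp E p g"
  unfolding rexp_sum_pmf[OF assms(1)] using assms(2) by (intro sum.cong) auto

text \<open>Independence of the elements enters only through this recursion. The ground set is
  arbitrary, so that it can be built up one element at a time.\<close>

lemma rexp_insert:
  assumes "finite E" "e \<notin> E" "0 \<le> p" "p \<le> 1"
  shows "rexp (insert e E) p g = p * rexp E p (\<lambda>G. g (insert e G)) + (1 - p) * rexp E p g"
proof -
  let ?B = "Pi_pmf E False (\<lambda>_. bernoulli_pmf p)"
  have "rsub (insert e E) p =
      map_pmf (\<lambda>(y, G). if y then insert e G else G) (pair_pmf (bernoulli_pmf p) (rsub E p))"
  proof -
    have "rsub (insert e E) p =
        map_pmf (\<lambda>(y, f). {x \<in> insert e E. (f(e := y)) x}) (pair_pmf (bernoulli_pmf p) ?B)"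
      using assms by (simp add: rsub_def Pi_pmf_insert map_pmf_comp case_prod_unfold)
    also have "\<dots> = map_pmf (\<lambda>(y, f). if y then insert e {x \<in> E. f x} else {x \<in> E. f x})
        (pair_pmf (bernoulli_pmf p) ?B)"
      using assms(2) by (intro map_pmf_cong refl) (auto simp: case_prod_unfold)
    finally show ?thesis
      by (simp add: rsub_def pair_map_pmf2 map_pmf_comp case_prod_unfold apsnd_def cong: if_cong)
  qed
  also have "\<dots> = bind_pmf (bernoulli_pmf p)
      (\<lambda>y. map_pmf (\<lambda>G. if y then insert e G else G) (rsub E p))"
    by (simp add: pair_pmf_def map_bind_pmf map_pmf_def bind_assoc_pmf bind_return_pmf)
  finally have *: "rsub (insert e E) p = \<dots>" .
  have "rexp (insert e E) p g = measure_pmf.expectation (bernoulli_pmf p)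
      (\<lambda>y. measure_pmf.expectation (map_pmf (\<lambda>G. if y then insert e G else G) (rsub E p)) g)"
    unfolding * using assms(1)
    by (subst pmf_expectation_bind[where A = "UNIV"]) 
       (auto simp: finite_set_rsub integral_measure_pmf[of UNIV])
  also have "\<dots> = p * rexp E p (\<lambda>G. g (insert e G)) + (1 - p) * rexp E p g"
    using assms(3,4) by simp
  finally show ?thesis .
qed

lemma rexp_avoid1:
  assumes "finite E" "e \<in> E" "0 \<le> p" "p \<le> 1"
  shows "rexp E p (\<lambda>G. if e \<notin> G then g G else 0) = (1 - p) * rexp E p (\<lambda>G. g (G - {e}))"
proof -
  obtain E' where E': "E = insert e E'" "e \<notin> E'" "finite E'"
    using assms(1,2) by (metis Set.set_insert finite_insert)
  have "rexp E' p (\<lambda>G. if e \<notin> G then g G else 0) = rexp E' p g"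
    using E' by (intro rexp_cong) auto
  moreover have "rexp E' p (\<lambda>G. g (G - {e})) = rexp E' p g"
    using E' by (intro rexp_cong arg_cong[of _ _ g]) auto
  moreover have "rexp E' p (\<lambda>G. g (insert e G - {e})) = rexp E' p g"
    using E' by (intro rexp_cong arg_cong[of _ _ g]) auto
  ultimately show ?thesis
    using E' assms(3,4) by (simp add: rexp_insert algebra_simps)
qed

lemma rexp_avoid:
  assumes "finite E" "A \<subseteq> E" "0 \<le> p" "p \<le> 1"
  shows "rexp E p (\<lambda>G. if A \<inter> G = {} then g G else 0) = (1 - p) ^ card A * rexp E p (\<lambda>G. g (G - A))"
proof -
  have "finite A" using assms finite_subset by blast
  then show ?thesis using assms(2)
  proof (induction A arbitrary: g rule: finite_induct)
    case (insert e A)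
    have "rexp E p (\<lambda>G. if insert e A \<inter> G = {} then g G else 0)
        = rexp E p (\<lambda>G. if A \<inter> G = {} then (if e \<notin> G then g G else 0) else 0)"
      by (intro rexp_cong) (use assms in auto)
    also have "\<dots> = (1 - p) ^ card A * rexp E p (\<lambda>G. if e \<notin> G then g (G - A) else 0)"
      using insert assms by (subst insert.IH) (auto intro!: rexp_cong)
    also have "\<dots> = (1 - p) ^ card (insert e A) * rexp E p (\<lambda>G. g (G - insert e A))"
      using insert assms by (subst rexp_avoid1) (auto simp: Diff_insert2[symmetric] Diff_insert[symmetric])
    finally show ?case .
  qed simp
qed

lemma prob_avoid:
  assumes "finite E" "A \<subseteq> E" "0 \<le> p" "p \<le> 1"
  shows "measure_pmf.prob (rsub E p) {G. A \<inter> G = {}} = (1 - p) ^ card A"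
proof -
  have "measure_pmf.prob (rsub E p) {G. A \<inter> G = {}}
      = rexp E p (indicator {G. A \<inter> G = {}})" by simp
  also have "\<dots> = rexp E p (\<lambda>G. if A \<inter> G = {} then 1 else 0)"
    by (intro rexp_cong assms) (auto simp: indicator_def)
  finally show ?thesis using rexp_avoid[OF assms, of "\<lambda>_. 1"] by simp
qed

text \<open>Each element of \<open>F\<close> contributes a factor 1 + p. The base 2 serves for the
  exponential Markov bound in \<open>prob_many_edges\<close>.\<close>

lemma rexp_pow2:
  assumes "finite E" "0 \<le> p" "p \<le> 1" 
  shows "F \<subseteq> E \<Longrightarrow> rexp E p (\<lambda>G. 2 ^ card (F \<inter> G)) = (1 + p) ^ card F"
  using assms(1)
proof (induction E arbitrary: F rule: finite_induct)
  case empty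
  then show ?case by simp
next
  case (insert e E)
  show ?case
  proof (cases "e \<in> F")
    case True
    define F' where "F' = F - {e}"
    have F': "F = insert e F'" "e \<notin> F'" "F' \<subseteq> E" using True insert by (auto simp: F'_def)
    have fin: "finite F'" using F' insert finite_subset by blast
    have "rexp E p (\<lambda>G. 2 ^ card (F \<inter> G)) = rexp E p (\<lambda>G. 2 ^ card (F' \<inter> G))"
      by (intro rexp_cong insert arg_cong[of _ _ "\<lambda>A. 2 ^ card A"]) (use F' insert in auto)
    moreover have "rexp E p (\<lambda>G. 2 ^ card (F \<inter> insert e G)) = rexp E p (\<lambda>G. 2 * 2 ^ card (F' \<inter> G))"
    proof (intro rexp_cong insert)
      fix G assume "G \<subseteq> E"
      then have "F \<inter> insert e G = insert e (F' \<inter> G)" "e \<notin> F' \<inter> G" using F' insert by auto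
      then show "2 ^ card (F \<inter> insert e G) = (2::real) * 2 ^ card (F' \<inter> G)" using fin by simp
    qed
    ultimately show ?thesis
      using insert.IH[OF F'(3)] F' fin insert.hyps assms(2,3)
      by (simp add: rexp_insert) (simp add: algebra_simps)
  next
    case False
    then have F: "F \<subseteq> E" using insert by auto
    have "rexp E p (\<lambda>G. 2 ^ card (F \<inter> insert e G)) = rexp E p (\<lambda>G. 2 ^ card (F \<inter> G))"
      using False by simp
    then show ?thesis using insert.IH[OF F] insert.hyps assms(2,3)
      by (simp add: rexp_insert) (simp add: algebra_simps)
  qed
qed

text \<open>
  No correlation inequality is needed: conditioning on \<open>A i\<close> being avoided amounts to deleting \<open>A i\<close>
  from the random set (\<open>rexp_avoid\<close>), and the functional at hand only grows under deletion.
  This gives \<open>- \<Psi>' s \<ge> (\<mu> - s \<Delta>) \<Psi> s\<close> for the Laplace transform \<open>\<Psi>\<close> of the number of avoided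
  sets; integrate up to \<open>s = \<mu> / \<Delta>\<close>.
\<close>
theorem janson:
  fixes A :: "'i \<Rightarrow> 'a set"
  assumes E: "finite E" and p: "0 \<le> p" "p \<le> 1" and I: "finite I"
    and A: "\<And>i. i \<in> I \<Longrightarrow> A i \<subseteq> E"
    and \<mu>: "\<mu> = (\<Sum>i\<in>I. (1 - p) ^ card (A i))"
    and \<Delta>: "\<Delta> = (\<Sum>i\<in>I. \<Sum>j\<in>{j \<in> I. A i \<inter> A j \<noteq> {}}. (1 - p) ^ card (A i \<union> A j))" "\<Delta> > 0"
  shows "measure_pmf.prob (rsub E p) {G. \<forall>i\<in>I. A i \<inter> G \<noteq> {}} \<le> exp (- (\<mu>\<^sup>2 / (2 * \<Delta>)))"
proof -
  define J where "J i G = (if A i \<inter> G = {} then 1 else 0::real)" for i G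
  define Y where "Y G = (\<Sum>i\<in>I. J i G)" for G
  define \<Psi> where "\<Psi> s = rexp E p (\<lambda>G. exp (- s * Y G))" for s
  define N where "N i = {j \<in> I. A i \<inter> A j \<noteq> {}}" for i
  define Q where "Q i = (\<Sum>j\<in>N i. (1 - p) ^ card (A i \<union> A j))" for i
  have J_antimono: "J i G \<le> J i (G - B)" for i G B
    by (auto simp: J_def)
  have \<Psi>_nonneg: "\<Psi> s \<ge> 0" for s
    unfolding \<Psi>_def by (intro integral_nonneg_AE) auto
  \<comment> \<open>Summed over \<open>i\<close>, this is the differential inequality for
    \<open>\<Psi>\<close>. A negative bracket makes it trivial, so afterwards the bracket may be
    used as a nonnegative factor.\<close>
  have key: "rexp E p (\<lambda>G. J i G * exp (- s * Y G)) \<ge> ((1 - p) ^ card (A i) - s * Q i) * \<Psi> s"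
    if i: "i \<in> I" and s: "s \<ge> 0" for i s
  proof (cases "(1 - p) ^ card (A i) - s * Q i \<ge> 0")
    case False
    have "((1 - p) ^ card (A i) - s * Q i) * \<Psi> s \<le> 0"
      using False \<Psi>_nonneg[of s] by (intro mult_nonpos_nonneg) auto
    also have "0 \<le> rexp E p (\<lambda>G. J i G * exp (- s * Y G))"
      by (intro integral_nonneg_AE) (auto simp: J_def)
    finally show ?thesis .
  next
    case True
    \<comment> \<open>\<open>Z\<close> collects the sets disjoint from \<open>A i\<close>, so
      deleting \<open>A i\<close> does not change it; \<open>X\<close> collects the others, with
      \<open>i\<close> itself if \<open>A i\<close> is nonempty.\<close>
    define Z where "Z G = (\<Sum>j\<in>I - N i. J j G)" for G
    define X where "X G = (\<Sum>j\<in>N i. J j G)" for G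
    define h where "h G = exp (- s * Z G)" for G
    have YXZ: "Y G = X G + Z G" for G
      unfolding Y_def X_def Z_def using I by (subst sum.subset_diff[of "N i" I]) (auto simp: N_def)
    have X0: "X G \<ge> 0" for G unfolding X_def by (intro sum_nonneg) (auto simp: J_def)
    have Z_indep: "Z (G - A i) = Z G" for G
      unfolding Z_def by (intro sum.cong refl) (auto simp: J_def N_def)
    have h_mono: "h (G - B) \<le> h G" for G B
      unfolding h_def Z_def using s J_antimono by (auto intro!: mult_left_mono sum_mono)
    have fst: "rexp E p (\<lambda>G. J i G * h G) = (1 - p) ^ card (A i) * rexp E p h"
    proof -
      have "rexp E p (\<lambda>G. J i G * h G) = rexp E p (\<lambda>G. if A i \<inter> G = {} then h G else 0)"
        by (intro rexp_cong E) (auto simp: J_def)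
      also have "\<dots> = (1 - p) ^ card (A i) * rexp E p (\<lambda>G. h (G - A i))"
        using rexp_avoid[OF E A[OF i] p] by simp
      finally show ?thesis unfolding h_def Z_indep .
    qed
    \<comment> \<open>Deleting \<open>A j\<close> as well can change \<open>Z\<close>, but only
      upwards; hence an inequality here, in contrast to \<open>fst\<close>.\<close>
    have snd: "rexp E p (\<lambda>G. J i G * J j G * h G) \<le> (1 - p) ^ card (A i \<union> A j) * rexp E p h"
      if j: "j \<in> I" for j
    proof -
      have "rexp E p (\<lambda>G. J i G * J j G * h G) = rexp E p (\<lambda>G. if (A i \<union> A j) \<inter> G = {} then h G else 0)"
        by (intro rexp_cong E) (auto simp: J_def)
      also have "\<dots> = (1 - p) ^ card (A i \<union> A j) * rexp E p (\<lambda>G. h (G - (A i \<union> A j)))"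
        using rexp_avoid[OF E _ p, of "A i \<union> A j"] A i j by simp
      also have "\<dots> \<le> (1 - p) ^ card (A i \<union> A j) * rexp E p h"
        using p h_mono by (intro mult_left_mono rexp_mono E) auto
      finally show ?thesis .
    qed
    \<comment> \<open>\<open>X\<close> is nonnegative, so \<open>\<Psi> s\<close> is at most the
      mean of \<open>h\<close>. After expanding the bracket, the bound exp (- y) \<ge> 1 - y brings
      \<open>X\<close> back into the exponent.\<close>
    have "((1 - p) ^ card (A i) - s * Q i) * \<Psi> s \<le> ((1 - p) ^ card (A i) - s * Q i) * rexp E p h"
      unfolding \<Psi>_def h_def using True s X0
      by (intro mult_left_mono rexp_mono E) (auto simp: YXZ intro: mult_left_mono)
    also have "\<dots> = (1 - p) ^ card (A i) * rexp E p h - s * (\<Sum>j\<in>N i. (1 - p) ^ card (A i \<union> A j) * rexp E p h)"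
      by (simp add: Q_def algebra_simps sum_distrib_left)
    also have "\<dots> \<le> rexp E p (\<lambda>G. J i G * h G) - s * (\<Sum>j\<in>N i. rexp E p (\<lambda>G. J i G * J j G * h G))"
      unfolding fst using s snd by (auto intro!: mult_left_mono sum_mono simp: N_def)
    also have "\<dots> = rexp E p (\<lambda>G. J i G * h G - s * (\<Sum>j\<in>N i. J i G * J j G * h G))"
      using E by simp
    also have "\<dots> = rexp E p (\<lambda>G. J i G * ((1 - s * X G) * h G))"
      by (intro rexp_cong E) (simp add: X_def sum_distrib_left sum_distrib_right algebra_simps)
    also have "\<dots> \<le> rexp E p (\<lambda>G. J i G * exp (- s * Y G))"
    proof (intro rexp_mono E mult_left_mono)
      fix G
      have "(1 - s * X G) * h G \<le> exp (- s * X G) * h G"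
        using exp_ge_add_one_self[of "- s * X G"] by (intro mult_right_mono) (auto simp: h_def)
      also have "\<dots> = exp (- s * Y G)"
        by (simp add: h_def YXZ algebra_simps exp_add[symmetric])
      finally show "(1 - s * X G) * h G \<le> exp (- s * Y G)" .
    qed (auto simp: J_def)
    finally show ?thesis .
  qed
  have \<Psi>_deriv: "(\<Psi> has_real_derivative - (\<Sum>i\<in>I. rexp E p (\<lambda>G. J i G * exp (- s * Y G)))) (at s)" for s
  proof -
    have "((\<lambda>s. \<Sum>R\<in>Pow E. exp (- s * Y R) * pmf (rsub E p) R) has_real_derivative
        (\<Sum>R\<in>Pow E. (- Y R * exp (- s * Y R)) * pmf (rsub E p) R)) (at s)"
      by (intro DERIV_sum) (auto intro!: derivative_eq_intros)
    also have "(\<lambda>s. \<Sum>R\<in>Pow E. exp (- s * Y R) * pmf (rsub E p) R) = \<Psi>"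
      by (auto simp: \<Psi>_def rexp_sum_pmf[OF E])
    also have "(\<Sum>R\<in>Pow E. (- Y R * exp (- s * Y R)) * pmf (rsub E p) R)
        = rexp E p (\<lambda>G. - (\<Sum>i\<in>I. J i G * exp (- s * Y G)))"
      unfolding rexp_sum_pmf[OF E] by (intro sum.cong refl) (simp add: Y_def sum_distrib_right)
    also have "\<dots> = - (\<Sum>i\<in>I. rexp E p (\<lambda>G. J i G * exp (- s * Y G)))"
      using E by simp
    finally show ?thesis .
  qed
  \<comment> \<open>Integrating factor: the differential inequality says that \<open>H\<close> has
    nonpositive derivative. The point \<mu> / \<Delta> maximises the quadratic in its
    exponent.\<close>
  define H where "H s = \<Psi> s * exp (\<mu> * s - \<Delta> * s\<^sup>2 / 2)" for s
  define s where "s = \<mu> / \<Delta>"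
  have \<mu>0: "\<mu> \<ge> 0" unfolding \<mu> using p by (intro sum_nonneg) auto
  then have s0: "s \<ge> 0" using \<Delta>(2) by (simp add: s_def)
  have "H s \<le> H 0"
  proof (rule DERIV_nonpos_imp_nonincreasing[OF s0])
    fix x :: real assume x: "0 \<le> x" "x \<le> s"
    define D where "D = - (\<Sum>i\<in>I. rexp E p (\<lambda>G. J i G * exp (- x * Y G)))"
    have "(H has_real_derivative (D + (\<mu> - \<Delta> * x) * \<Psi> x) * exp (\<mu> * x - \<Delta> * x\<^sup>2 / 2)) (at x)"
      unfolding H_def using \<Psi>_deriv[of x, folded D_def]
      by (auto intro!: derivative_eq_intros simp: algebra_simps)
    moreover have "(\<mu> - \<Delta> * x) * \<Psi> x = (\<Sum>i\<in>I. ((1 - p) ^ card (A i) - x * Q i) * \<Psi> x)"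
      by (simp add: \<mu> \<Delta>(1) Q_def N_def sum_subtractf sum_distrib_left sum_distrib_right algebra_simps)
    then have "D + (\<mu> - \<Delta> * x) * \<Psi> x \<le> 0"
      unfolding D_def using key x(1) by (simp add: sum_mono)
    ultimately show "\<exists>y. (H has_real_derivative y) (at x) \<and> y \<le> 0"
      by (blast intro: mult_nonpos_nonneg exp_ge_zero)
  qed
  moreover have "H 0 = 1" by (simp add: H_def \<Psi>_def)
  ultimately have "\<Psi> s * exp (\<mu>\<^sup>2 / (2 * \<Delta>)) \<le> 1"
    using \<Delta>(2) by (simp add: H_def s_def power2_eq_square field_simps)
  then have "\<Psi> s \<le> exp (- (\<mu>\<^sup>2 / (2 * \<Delta>)))"
    by (simp add: exp_minus field_simps)
  moreover have "measure_pmf.prob (rsub E p) {G. \<forall>i\<in>I. A i \<inter> G \<noteq> {}} \<le> \<Psi> s"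
  proof -
    have "measure_pmf.prob (rsub E p) {G. \<forall>i\<in>I. A i \<inter> G \<noteq> {}}
        = rexp E p (indicator {G. \<forall>i\<in>I. A i \<inter> G \<noteq> {}})" by simp
    also have "\<dots> \<le> \<Psi> s"
      unfolding \<Psi>_def by (intro rexp_mono E) (auto simp: indicator_def Y_def J_def)
    finally show ?thesis .
  qed
  ultimately show ?thesis by linarith
qed

section \<open>Orthogonal colourings\<close>

text \<open>Greedy colouring along a degeneracy order: set a vertex of low degree aside, colour the
  rest, and one of the \<open>D\<close> colours is still free for it. The degree hypothesis concerns
  all nonempty subsets so that it survives the removal.\<close>

lemma degenerate_colorable:
  fixes R :: "'a \<Rightarrow> 'a \<Rightarrow> bool"
  assumes "finite W" and sym: "\<And>u v. R u v \<Longrightarrow> R v u" and irr: "\<And>u. \<not> R u u"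
    and "\<And>U. U \<subseteq> W \<Longrightarrow> U \<noteq> {} \<Longrightarrow> \<exists>v\<in>U. card {u \<in> U. R u v} < D"
  shows "\<exists>c :: 'a \<Rightarrow> nat. (\<forall>v\<in>W. c v < D) \<and> (\<forall>u\<in>W. \<forall>v\<in>W. R u v \<longrightarrow> c u \<noteq> c v)"
  using assms(1,4)
proof (induction "card W" arbitrary: W)
  case 0
  then show ?case by simp
next
  case (Suc N)
  then have "W \<noteq> {}" by auto
  with Suc.prems obtain v where v: "v \<in> W" "card {u \<in> W. R u v} < D" by blast
  have "\<exists>c :: 'a \<Rightarrow> nat. (\<forall>u\<in>W - {v}. c u < D) \<and> (\<forall>u\<in>W - {v}. \<forall>w\<in>W - {v}. R u w \<longrightarrow> c u \<noteq> c w)"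
    using Suc.hyps(2) Suc.prems v(1) by (intro Suc.hyps(1)) auto
  then obtain c :: "'a \<Rightarrow> nat" where c: "\<forall>u\<in>W - {v}. c u < D"
      "\<forall>u\<in>W - {v}. \<forall>w\<in>W - {v}. R u w \<longrightarrow> c u \<noteq> c w" by blast
  have "card (c ` {u \<in> W. R u v}) < card {..<D}"
    using card_image_le[of "{u \<in> W. R u v}" c] v(2) Suc.prems(1) by simp
  then have "\<not> {..<D} \<subseteq> c ` {u \<in> W. R u v}"
    using Suc.prems(1) card_mono[of "c ` {u \<in> W. R u v}" "{..<D}"] by force
  then obtain a where "a < D" "a \<notin> c ` {u \<in> W. R u v}" by auto
  then have a: "a < D" "\<And>u. u \<in> W \<Longrightarrow> R u v \<Longrightarrow> c u \<noteq> a" by auto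
  show ?case
  proof (intro exI[of _ "c(v := a)"] conjI ballI impI)
    fix u w assume *: "u \<in> W" "w \<in> W" "R u w"
    then show "(c(v := a)) u \<noteq> (c(v := a)) w"
      using c(2) a(2)[of u] a(2)[of w] sym[of u w] irr[of v] by auto
  qed (use c(1) a(1) in auto)
qed

text \<open>Every extracted set costs one colour and exactly \<open>k\<close> vertices, so
  \<open>card W div k\<close> drops by one each time. Its colour lies just above all colours used by
  the recursive call.\<close>

lemma chunk_colorable:
  fixes R :: "'a \<Rightarrow> 'a \<Rightarrow> bool"
  assumes "finite W" and "k > 0"
    and "\<And>U. U \<subseteq> W \<Longrightarrow> card U \<ge> m \<Longrightarrow> \<exists>S\<subseteq>U. card S = k \<and> (\<forall>u\<in>S. \<forall>v\<in>S. \<not> R u v)"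
    and "\<And>U. U \<subseteq> W \<Longrightarrow> card U < m \<Longrightarrow>
      \<exists>c :: 'a \<Rightarrow> nat. (\<forall>v\<in>U. c v < D) \<and> (\<forall>u\<in>U. \<forall>v\<in>U. R u v \<longrightarrow> c u \<noteq> c v)"
  shows "\<exists>c :: 'a \<Rightarrow> nat. (\<forall>v\<in>W. c v < card W div k + D) \<and> (\<forall>u\<in>W. \<forall>v\<in>W. R u v \<longrightarrow> c u \<noteq> c v)"
  using assms(1,3,4)
proof (induction "card W" arbitrary: W rule: less_induct)
  case less
  show ?case
  proof (cases "card W < m")
    case True
    obtain c :: "'a \<Rightarrow> nat" where "\<forall>v\<in>W. c v < D" "\<forall>u\<in>W. \<forall>v\<in>W. R u v \<longrightarrow> c u \<noteq> c v"
      using less.prems(3)[OF order_refl True] by blast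
    then show ?thesis by (intro exI[of _ c]) auto
  next
    case False
    then obtain S where S: "S \<subseteq> W" "card S = k" "\<forall>u\<in>S. \<forall>v\<in>S. \<not> R u v"
      using less.prems(2)[OF order_refl] by auto
    have fS: "finite S" using S less.prems(1) finite_subset by blast
    have card: "card (W - S) = card W - k" "k \<le> card W"
      using S fS less.prems(1) by (auto simp: card_Diff_subset intro: card_mono)
    have div: "card W div k = Suc ((card W - k) div k)"
      using card(2) assms(2) by (simp add: le_div_geq)
    have "\<exists>c :: 'a \<Rightarrow> nat. (\<forall>v\<in>W - S. c v < card (W - S) div k + D) \<and>
        (\<forall>u\<in>W - S. \<forall>v\<in>W - S. R u v \<longrightarrow> c u \<noteq> c v)"
    proof (rule less.hyps)
      show "card (W - S) < card W" using card assms(2) by simp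
      show "finite (W - S)" using less.prems(1) by simp
    qed (rule less.prems; blast)+
    then obtain c :: "'a \<Rightarrow> nat" where c: "\<forall>v\<in>W - S. c v < (card W - k) div k + D"
        "\<forall>u\<in>W - S. \<forall>v\<in>W - S. R u v \<longrightarrow> c u \<noteq> c v" unfolding card by blast
    show ?thesis unfolding div
    proof (intro exI[of _ "\<lambda>v. if v \<in> S then (card W - k) div k + D else c v"] conjI ballI impI)
      fix v assume "v \<in> W"
      then show "(if v \<in> S then (card W - k) div k + D else c v) < Suc ((card W - k) div k) + D"
        using c(1) by (cases "v \<in> S") (auto intro: less_SucI)
    next
      fix u v assume *: "u \<in> W" "v \<in> W" "R u v"
      show "(if u \<in> S then (card W - k) div k + D else c u)
          \<noteq> (if v \<in> S then (card W - k) div k + D else c v)"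
      proof (cases "u \<in> S"; cases "v \<in> S")
        assume "u \<in> S" "v \<in> S"
        then show ?thesis using S(3) *(3) by blast
      next
        assume uv: "u \<in> S" "v \<notin> S"
        then have "c v < (card W - k) div k + D" using c(1) *(2) by blast
        then show ?thesis using uv by simp
      next
        assume uv: "u \<notin> S" "v \<in> S"
        then have "c u < (card W - k) div k + D" using c(1) *(1) by blast
        then show ?thesis using uv by simp
      next
        assume uv: "u \<notin> S" "v \<notin> S"
        then have "c u \<noteq> c v" using c(2) * by blast
        then show ?thesis using uv by simp
      qed
    qed
  qed
qed

section \<open>Deterministic graph properties and the successive construction of colourings\<close>

definition indep :: "nat set set \<Rightarrow> nat set \<Rightarrow> bool" where
  "indep G S \<longleftrightarrow> (\<forall>u\<in>S. \<forall>v\<in>S. {u, v} \<notin> G)"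

definition small_alpha :: "nat \<Rightarrow> nat \<Rightarrow> nat set set \<Rightarrow> bool" where
  "small_alpha n K G \<longleftrightarrow> (\<forall>S\<subseteq>{..<n}. card S = K \<longrightarrow> \<not> indep G S)"

definition bounded_fibres :: "nat \<Rightarrow> nat \<Rightarrow> nat \<Rightarrow> (nat \<times> nat \<Rightarrow> nat) \<Rightarrow> bool" where
  "bounded_fibres n K t c \<longleftrightarrow> (\<forall>r<t. \<forall>a. card {v \<in> {..<n}. c (r, v) = a} \<le> K)"

text \<open>The \<open>t\<close> colourings are packed into one function from a finite function
  space, so that a union bound can count them. Only their class sizes are restricted, not
  properness, which makes the range of \<open>c\<close> independent of \<open>G\<close>. Injectivity
  on \<open>S\<close> says that \<open>S\<close> meets every class at most once.\<close>

definition rich :: "nat \<Rightarrow> nat \<Rightarrow> nat \<Rightarrow> nat \<Rightarrow> nat \<Rightarrow> nat set set \<Rightarrow> bool" where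
  "rich n t K k m G \<longleftrightarrow> (\<forall>W\<subseteq>{..<n}. m \<le> card W \<longrightarrow>
     (\<forall>c\<in>PiE ({..<t} \<times> {..<n}) (\<lambda>_. {..<n}). bounded_fibres n K t c \<longrightarrow>
        (\<exists>S\<subseteq>W. card S = k \<and> indep G S \<and> (\<forall>r<t. inj_on (\<lambda>v. c (r, v)) S))))"

text \<open>Says that induced subgraphs on at most \<open>m\<close> vertices are (d -
  1)-degenerate.\<close>

definition locally_sparse :: "nat \<Rightarrow> nat \<Rightarrow> nat \<Rightarrow> nat set set \<Rightarrow> bool" where
  "locally_sparse n m d G \<longleftrightarrow>
     (\<forall>U\<subseteq>{..<n}. U \<noteq> {} \<longrightarrow> card U \<le> m \<longrightarrow> (\<exists>v\<in>U. card {u \<in> U. {u, v} \<in> G} < d))"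

lemma all_edges_no_loop: "G \<subseteq> all_edges n \<Longrightarrow> {u, u} \<notin> G"
  by (auto simp: all_edges_def)

lemma indep_card_less:
  assumes "small_alpha n K G" "S \<subseteq> {..<n}" "indep G S"
  shows "card S < K"
proof (rule ccontr)
  assume "\<not> card S < K"
  then obtain S' where S': "S' \<subseteq> S" "card S' = K" by (meson linorder_not_less obtain_subset_with_card_n)
  then have "indep G S'" "S' \<subseteq> {..<n}" using assms(2,3) by (auto simp: indep_def)
  then show False using assms(1) S' by (auto simp: small_alpha_def)
qed

lemma proper_bounded_fibres:
  assumes "small_alpha n K G" "\<forall>u<n. \<forall>v<n. {u, v} \<in> G \<longrightarrow> f u \<noteq> f v"
  shows "card {v \<in> {..<n}. f v = a} \<le> K"
proof (rule less_imp_le, rule indep_card_less[OF assms(1)])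
  show "indep G {v \<in> {..<n}. f v = a}" 
    unfolding indep_def
  proof (intro ballI)
    fix u v assume "u \<in> {v \<in> {..<n}. f v = a}" "v \<in> {v \<in> {..<n}. f v = a}"
    then have "u < n" "v < n" "f u = f v" by auto
    then show "{u, v} \<notin> G" using assms(2) by blast
  qed
qed auto

text \<open>Properness and orthogonality together are one proper colouring problem, for the relation
  \<open>R\<close>. \<open>rich\<close> supplies the large classes; in the remainder a vertex has
  fewer than \<open>d\<close> conflicts from \<open>G\<close> and at most \<open>K\<close> from each
  of the \<open>t\<close> given colourings.\<close>

lemma extend_coloring:
  assumes G: "G \<subseteq> all_edges n"
    and rich: "rich n t K k m G" and sparse: "locally_sparse n m d G"
    and c: "\<And>r v. r < t \<Longrightarrow> v < n \<Longrightarrow> c r v < n"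
    and fib: "\<And>r a. r < t \<Longrightarrow> card {v \<in> {..<n}. c r v = a} \<le> K"
    and pos: "0 < k" "0 < d"
  shows "\<exists>f. (\<forall>v<n. f v < n div k + (d + t * K)) \<and>
    (\<forall>u<n. \<forall>v<n. u \<noteq> v \<longrightarrow> {u, v} \<in> G \<or> (\<exists>r<t. c r u = c r v) \<longrightarrow> f u \<noteq> f v)"
proof -
  define R where "R u v \<longleftrightarrow> u \<noteq> v \<and> ({u, v} \<in> G \<or> (\<exists>r<t. c r u = c r v))" for u v
  define c' where "c' = restrict (\<lambda>(r, v). c r v) ({..<t} \<times> {..<n})"
  have "\<exists>f :: nat \<Rightarrow> nat. (\<forall>v\<in>{..<n}. f v < card {..<n} div k + (d + t * K)) \<and>
      (\<forall>u\<in>{..<n}. \<forall>v\<in>{..<n}. R u v \<longrightarrow> f u \<noteq> f v)"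
  proof (rule chunk_colorable)
    fix U assume U: "U \<subseteq> {..<n}" "m \<le> card U"
    have "c' \<in> PiE ({..<t} \<times> {..<n}) (\<lambda>_. {..<n})" using c by (auto simp: c'_def)
    moreover have "bounded_fibres n K t c'"
      unfolding bounded_fibres_def
    proof (intro allI impI)
      fix r a assume r: "r < t"
      have "{v \<in> {..<n}. c' (r, v) = a} = {v \<in> {..<n}. c r v = a}" using r by (auto simp: c'_def)
      then show "card {v \<in> {..<n}. c' (r, v) = a} \<le> K" using fib[OF r, of a] by simp
    qed
    ultimately obtain S where S: "S \<subseteq> U" "card S = k" "indep G S" "\<forall>r<t. inj_on (\<lambda>v. c' (r, v)) S"
      using rich U unfolding rich_def by blast
    have "\<not> R u v" if uv: "u \<in> S" "v \<in> S" for u v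
    proof
      assume "R u v"
      then consider "{u, v} \<in> G" | r where "u \<noteq> v" "r < t" "c r u = c r v" by (auto simp: R_def)
      then show False
      proof cases
        case 1
        then show False using S(3) uv by (auto simp: indep_def)
      next
        case (2 r)
        then have "c' (r, u) = c' (r, v)" using S(1) U(1) uv by (auto simp: c'_def)
        then show False using 2 S(4) uv by (auto dest: inj_onD)
      qed
    qed
    then show "\<exists>S\<subseteq>U. card S = k \<and> (\<forall>u\<in>S. \<forall>v\<in>S. \<not> R u v)" using S by blast
  next
    fix U assume U: "U \<subseteq> {..<n}" "card U < m"
    show "\<exists>f :: nat \<Rightarrow> nat. (\<forall>v\<in>U. f v < d + t * K) \<and> (\<forall>u\<in>U. \<forall>v\<in>U. R u v \<longrightarrow> f u \<noteq> f v)"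
    proof (rule degenerate_colorable)
      show "finite U" using U finite_subset by blast
      show "R u v \<Longrightarrow> R v u" for u v unfolding R_def by (metis insert_commute)
      show "\<not> R u u" for u by (simp add: R_def)
      fix V assume V: "V \<subseteq> U" "V \<noteq> {}"
      have fV: "finite V" using V(1) \<open>finite U\<close> by (rule finite_subset)
      have "card V \<le> m" using V U card_mono[OF \<open>finite U\<close> V(1)] by linarith
      moreover have "V \<subseteq> {..<n}" using V(1) U(1) by (rule subset_trans)
      ultimately obtain v where v: "v \<in> V" "card {u \<in> V. {u, v} \<in> G} < d"
        using sparse V(2) unfolding locally_sparse_def by blast
      have "{u \<in> V. R u v} \<subseteq> {u \<in> V. {u, v} \<in> G} \<union> (\<Union>r<t. {u \<in> {..<n}. c r u = c r v})"
        using V U by (auto simp: R_def)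
      then have "card {u \<in> V. R u v} \<le> card ({u \<in> V. {u, v} \<in> G} \<union> (\<Union>r<t. {u \<in> {..<n}. c r u = c r v}))"
        using fV by (intro card_mono) auto
      also have "\<dots> \<le> card {u \<in> V. {u, v} \<in> G} + card (\<Union>r<t. {u \<in> {..<n}. c r u = c r v})"
        by (rule card_Un_le)
      also have "card (\<Union>r<t. {u \<in> {..<n}. c r u = c r v}) \<le> (\<Sum>r<t. card {u \<in> {..<n}. c r u = c r v})"
        by (rule card_UN_le) simp
      also have "\<dots> \<le> (\<Sum>r<t. K)" using fib by (intro sum_mono) auto
      finally have "card {u \<in> V. R u v} < d + t * K" using v(2) by simp
      then show "\<exists>v\<in>V. card {u \<in> V. R u v} < d + t * K" using v(1) by blast
    qed
  qed (use pos in auto)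
  then obtain f where f: "\<forall>v\<in>{..<n}. f v < card {..<n} div k + (d + t * K)"
    "\<forall>u\<in>{..<n}. \<forall>v\<in>{..<n}. R u v \<longrightarrow> f u \<noteq> f v" by (elim exE conjE)
  show ?thesis
  proof (intro exI[of _ f] conjI allI impI)
    fix u v assume "u < n" "v < n" "u \<noteq> v" "{u, v} \<in> G \<or> (\<exists>r<t. c r u = c r v)"
    then show "f u \<noteq> f v" using f(2) unfolding R_def by blast
  qed (use f(1) in simp)
qed

text \<open>The palette bound by \<open>n\<close> keeps each finished colouring inside the function
  space over which \<open>rich\<close> quantifies, and \<open>small_alpha\<close> bounds its classes
  by \<open>K\<close>; so \<open>extend_coloring\<close> applies again.\<close>

lemma orthogonal_colorings:
  assumes G: "G \<subseteq> all_edges n" and \<alpha>: "small_alpha n K G"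
    and rich: "rich n t K k m G" and sparse: "locally_sparse n m d G"
    and pos: "0 < k" "0 < d" "0 < K" and M: "n div k + (d + t * K) \<le> n"
  shows "s \<le> t \<Longrightarrow> \<exists>c :: nat \<Rightarrow> nat \<Rightarrow> nat.
    (\<forall>r<s. \<forall>v<n. c r v < n div k + (d + t * K)) \<and>
    (\<forall>r<s. \<forall>u<n. \<forall>v<n. {u, v} \<in> G \<longrightarrow> c r u \<noteq> c r v) \<and>
    (\<forall>r<s. \<forall>r'<s. r \<noteq> r' \<longrightarrow> (\<forall>u<n. \<forall>v<n. u \<noteq> v \<longrightarrow> c r u = c r v \<longrightarrow> c r' u \<noteq> c r' v))"
proof (induction s)
  case 0
  then show ?case by simp
next
  case (Suc s)
  then obtain c :: "nat \<Rightarrow> nat \<Rightarrow> nat" where c: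
    "\<forall>r<s. \<forall>v<n. c r v < n div k + (d + t * K)"
    "\<forall>r<s. \<forall>u<n. \<forall>v<n. {u, v} \<in> G \<longrightarrow> c r u \<noteq> c r v"
    "\<forall>r<s. \<forall>r'<s. r \<noteq> r' \<longrightarrow> (\<forall>u<n. \<forall>v<n. u \<noteq> v \<longrightarrow> c r u = c r v \<longrightarrow> c r' u \<noteq> c r' v)"
    by auto
  \<comment> \<open>The identity is an injective colouring, so it puts no constraint on the tones still missing.\<close>
  define c0 where "c0 r = (if r < s then c r else id)" for r
  have "\<exists>f. (\<forall>v<n. f v < n div k + (d + t * K)) \<and>
    (\<forall>u<n. \<forall>v<n. u \<noteq> v \<longrightarrow> {u, v} \<in> G \<or> (\<exists>r<t. c0 r u = c0 r v) \<longrightarrow> f u \<noteq> f v)"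
  proof (rule extend_coloring[OF G rich sparse _ _ pos(1,2)])
    fix r v assume "r < t" "v < n"
    then show "c0 r v < n" using c(1) M by (auto simp: c0_def intro: less_le_trans)
  next
    fix r a assume "r < t"
    show "card {v \<in> {..<n}. c0 r v = a} \<le> K"
    proof (cases "r < s")
      case True
      then show ?thesis using proper_bounded_fibres[OF \<alpha>, of "c r" a] c(2) by (simp add: c0_def)
    next
      case False
      have "card {v \<in> {..<n}. c0 r v = a} \<le> card {a}"
        using False by (intro card_mono) (auto simp: c0_def)
      then show ?thesis using pos by simp
    qed
  qed
  then obtain f where f: "\<forall>v<n. f v < n div k + (d + t * K)"
    "\<forall>u<n. \<forall>v<n. u \<noteq> v \<longrightarrow> {u, v} \<in> G \<or> (\<exists>r<t. c0 r u = c0 r v) \<longrightarrow> f u \<noteq> f v" by blast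
  have f1: "f u \<noteq> f v" if "u < n" "v < n" "{u, v} \<in> G" for u v
    using f(2) that all_edges_no_loop[OF G, of u] by (cases "u = v") auto
  have f2: "f u \<noteq> f v" if "u < n" "v < n" "u \<noteq> v" "r < s" "c r u = c r v" for u v r
  proof -
    have "r < t" "c0 r u = c0 r v" using that Suc.prems by (auto simp: c0_def)
    then show ?thesis using f(2) that by blast
  qed
  show ?case
  proof (intro exI[of _ "c(s := f)"] conjI allI impI)
    fix r v assume "r < Suc s" "v < n"
    then show "(c(s := f)) r v < n div k + (d + t * K)" using f(1) c(1) by (auto simp: less_Suc_eq)
  next
    fix r u v assume "r < Suc s" "u < n" "v < n" "{u, v} \<in> G"
    then show "(c(s := f)) r u \<noteq> (c(s := f)) r v" using f1 c(2) by (auto simp: less_Suc_eq)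
  next
    fix r r' u v assume *: "r < Suc s" "r' < Suc s" "r \<noteq> r'" "u < n" "v < n" "u \<noteq> v"
      "(c(s := f)) r u = (c(s := f)) r v"
    show "(c(s := f)) r' u \<noteq> (c(s := f)) r' v"
    proof (cases "r = s \<or> r' = s")
      case True
      then consider "r = s" "r' < s" | "r' = s" "r < s" using *(1-3) by (auto simp: less_Suc_eq)
      then show ?thesis
      proof cases
        case 1
        then show ?thesis using *(4-7) f2[of u v r'] by auto
      next
        case 2
        then show ?thesis using *(4-7) f2[of u v r] by auto
      qed
    next
      case False
      then have "r < s" "r' < s" "c r u = c r v" using * by (auto simp: less_Suc_eq)
      then have "c r' u \<noteq> c r' v" using c(3) *(3-6) by blast
      then show ?thesis using False by simp
    qed
  qed
qed

section \<open>Tone colourings: distances, disjoint palettes and counting bounds\<close>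

lemma gdist_gt0: "u \<noteq> v \<Longrightarrow> gdist E u v \<ge> 1"
proof -
  assume uv: "u \<noteq> v"
  have "(LEAST k. has_walk E u v k) \<noteq> 0" if "has_walk E u v k" for k
    using LeastI[of "has_walk E u v" k, OF that] uv by (metis has_walk.simps(1))
  then show ?thesis
    by (auto simp: gdist_def one_enat_def Suc_le_eq)
qed

lemma gdist_gt1: "u \<noteq> v \<Longrightarrow> {u, v} \<notin> E \<Longrightarrow> gdist E u v \<ge> 2"
proof -
  assume uv: "u \<noteq> v" "{u, v} \<notin> E"
  have "(LEAST k. has_walk E u v k) \<ge> 2" if "has_walk E u v k" for k
  proof -
    have "has_walk E u v (LEAST k. has_walk E u v k)" using that by (rule LeastI)
    moreover have "\<not> has_walk E u v 0" "\<not> has_walk E u v (Suc 0)" using uv by auto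
    ultimately show ?thesis by (metis One_nat_def Suc_1 less_2_cases linorder_not_less)
  qed
  then show ?thesis
    by (auto simp: gdist_def numeral_eq_enat)
qed

lemma gdist_edge: "u \<noteq> v \<Longrightarrow> {u, v} \<in> E \<Longrightarrow> gdist E u v \<le> 1"
proof -
  assume uv: "u \<noteq> v" "{u, v} \<in> E"
  have *: "has_walk E u v 1" using uv by auto
  then have "(LEAST k. has_walk E u v k) \<le> 1" by (rule Least_le)
  then show ?thesis using exI[of "has_walk E u v", OF *] by (simp add: gdist_def one_enat_def)
qed

text \<open>The colourings get disjoint palettes, blocks of length \<open>M\<close> shifted by one
  so as to start at 1. A common tone of two vertices then comes from a colouring that agrees on
  both: adjacent vertices share none, other pairs at most one, and the latter have distance at least
  2.\<close>

lemma tone_coloring_of_orthogonal: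
  assumes c: "\<And>r v. r < t \<Longrightarrow> v < n \<Longrightarrow> c r v < M"
    and proper: "\<And>r u v. r < t \<Longrightarrow> u < n \<Longrightarrow> v < n \<Longrightarrow> {u, v} \<in> G \<Longrightarrow> c r u \<noteq> c r v"
    and orth: "\<And>r r' u v. r < t \<Longrightarrow> r' < t \<Longrightarrow> r \<noteq> r' \<Longrightarrow> u < n \<Longrightarrow> v < n \<Longrightarrow> u \<noteq> v \<Longrightarrow>
      c r u = c r v \<Longrightarrow> c r' u \<noteq> c r' v"
  shows "tone_coloring n G t (t * M) (\<lambda>v. (\<lambda>r. Suc (r * M + c r v)) ` {..<t})"
proof -
  have eqD: "r = r' \<and> x = y" if "r * M + x = r' * M + y" "x < M" "y < M" for r r' x y
  proof -
    have "(r * M + x) div M = r" "(r' * M + y) div M = r'" using that(2,3) by auto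
    then show ?thesis using that(1) by auto
  qed
  define f where "f v = (\<lambda>r. Suc (r * M + c r v)) ` {..<t}" for v
  have sub: "f v \<subseteq> {1..t * M}" "card (f v) = t" if v: "v < n" for v
  proof -
    show "f v \<subseteq> {1..t * M}"
    proof
      fix x assume "x \<in> f v"
      then obtain r where r: "r < t" "x = Suc (r * M + c r v)" by (auto simp: f_def)
      have "r * M + c r v < Suc r * M" using c[OF r(1) v] by simp
      also have "\<dots> \<le> t * M" using r(1) by (intro mult_le_mono1) simp
      finally show "x \<in> {1..t * M}" using r by simp
    qed
    have "inj_on (\<lambda>r. Suc (r * M + c r v)) {..<t}"
      using c v eqD by (intro inj_onI) (metis lessThan_iff nat.inject)
    then show "card (f v) = t" by (simp add: f_def card_image)
  qed
  have int: "f u \<inter> f v = (\<lambda>r. Suc (r * M + c r u)) ` {r. r < t \<and> c r u = c r v}"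
    if "u < n" "v < n" for u v
  proof (intro equalityI subsetI)
    fix x assume "x \<in> f u \<inter> f v"
    then obtain r r' where r: "r < t" "r' < t" "x = Suc (r * M + c r u)" "x = Suc (r' * M + c r' v)"
      by (auto simp: f_def)
    then have "r = r' \<and> c r u = c r' v" using that c by (intro eqD) auto
    then show "x \<in> (\<lambda>r. Suc (r * M + c r u)) ` {r. r < t \<and> c r u = c r v}" using r by (intro image_eqI[of _ _ r]) auto
  next
    fix x assume "x \<in> (\<lambda>r. Suc (r * M + c r u)) ` {r. r < t \<and> c r u = c r v}"
    then obtain r where "r < t" "c r u = c r v" "x = Suc (r * M + c r u)" by blast
    then show "x \<in> f u \<inter> f v" unfolding f_def by (intro IntI image_eqI[of _ _ r]) auto
  qed
  have "enat (card (f u \<inter> f v)) < gdist G u v" if uv: "u < n" "v < n" "u \<noteq> v" for u v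
  proof (cases "{u, v} \<in> G")
    case True
    then have "f u \<inter> f v = {}" unfolding int[OF uv(1,2)] using proper[OF _ uv(1,2) True] by auto
    then have "enat (card (f u \<inter> f v)) < 1" by (simp add: one_enat_def)
    then show ?thesis using gdist_gt0[OF uv(3)] by (rule less_le_trans)
  next
    case False
    have "card (f u \<inter> f v) \<le> card {r. r < t \<and> c r u = c r v}"
      unfolding int[OF uv(1,2)] by (intro card_image_le) auto
    also have "\<dots> \<le> Suc 0"
    proof (subst card_le_Suc0_iff_eq, simp, intro ballI)
      fix r r' assume "r \<in> {r. r < t \<and> c r u = c r v}" "r' \<in> {r. r < t \<and> c r u = c r v}"
      then show "r = r'" using orth[OF _ _ _ uv, of r r'] by auto
    qed
    finally have "enat (card (f u \<inter> f v)) < 2" by (simp add: numeral_eq_enat)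
    then show ?thesis using gdist_gt1[OF uv(3) False] by (rule less_le_trans)
  qed
  then show ?thesis unfolding tone_coloring_def f_def[symmetric] using sub by auto
qed

text \<open>Double counting of pairs of a vertex and one of its tones. Adjacent vertices have
  distance 1 and share no tone, so the vertices carrying a given tone are independent.\<close>

lemma tone_coloring_lower:
  assumes f: "tone_coloring n G t k f" and \<alpha>: "small_alpha n K G" and G: "G \<subseteq> all_edges n"
  shows "t * n \<le> k * K"
proof -
  have "t * n = (\<Sum>v<n. card (f v))" using f by (simp add: tone_coloring_def)
  also have "\<dots> = (\<Sum>v<n. \<Sum>i\<in>{1..k}. if i \<in> f v then 1 else 0)"
    using f by (intro sum.cong refl) (auto simp: tone_coloring_def sum.If_cases Int_absorb1)
  also have "\<dots> = (\<Sum>i\<in>{1..k}. \<Sum>v<n. if i \<in> f v then 1 else 0)" by (rule sum.swap)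
  also have "\<dots> = (\<Sum>i\<in>{1..k}. card {v \<in> {..<n}. i \<in> f v})"
    by (intro sum.cong refl) (simp add: sum.If_cases Int_def)
  also have "\<dots> \<le> (\<Sum>i\<in>{1..k}. K)"
  proof (rule sum_mono, rule less_imp_le, rule indep_card_less[OF \<alpha>])
    fix i
    show "{v \<in> {..<n}. i \<in> f v} \<subseteq> {..<n}" by auto
    show "indep G {v \<in> {..<n}. i \<in> f v}"
      unfolding indep_def
    proof (intro ballI notI)
      fix u v assume uv: "u \<in> {v \<in> {..<n}. i \<in> f v}" "v \<in> {v \<in> {..<n}. i \<in> f v}" "{u, v} \<in> G"
      then have ne: "u \<noteq> v" using all_edges_no_loop[OF G] by auto
      have "enat (card (f u \<inter> f v)) < gdist G u v" "f u \<subseteq> {1..k}"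
        using f uv(1,2) ne unfolding tone_coloring_def by auto
      then have "enat (card (f u \<inter> f v)) < 1" "finite (f u)"
        using gdist_edge[OF ne uv(3)] finite_subset by (blast intro: less_le_trans, blast)
      then have "card (f u \<inter> f v) = 0" by (simp add: one_enat_def)
      moreover note \<open>finite (f u)\<close>
      ultimately show False using uv by auto
    qed
  qed
  finally show ?thesis by simp
qed

lemma coloring_lower:
  assumes c: "\<forall>v<n. c v < k" "\<forall>u<n. \<forall>v<n. {u, v} \<in> G \<longrightarrow> c u \<noteq> c v" and \<alpha>: "small_alpha n K G"
  shows "n \<le> k * K"
proof -
  have "{..<n} = (\<Union>i<k. {v \<in> {..<n}. c v = i})" using c(1) by blast
  then have "card {..<n} = card (\<Union>i<k. {v \<in> {..<n}. c v = i})" by (rule arg_cong)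
  also have "\<dots> \<le> (\<Sum>i<k. card {v \<in> {..<n}. c v = i})" by (rule card_UN_le) simp
  also have "\<dots> \<le> (\<Sum>i<k. K)" using proper_bounded_fibres[OF \<alpha> c(2)] by (intro sum_mono)
  finally show ?thesis by simp
qed

text \<open>The lower bounds also rely on the constructed colourings: a \<open>LEAST\<close> is
  known to be attained only once some admissible value exists.\<close>

lemma tau_chi_bounds:
  assumes G: "G \<subseteq> all_edges n" and \<alpha>: "small_alpha n K G"
    and rich: "rich n t K k m G" and sparse: "locally_sparse n m d G"
    and pos: "0 < k" "0 < d" "0 < K" "0 < t" and M: "M = n div k + (d + t * K)" "M \<le> n"
  shows "tau t n G \<le> t * M" "chi n G \<le> M" "t * n \<le> tau t n G * K" "n \<le> chi n G * K"
proof -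
  obtain c :: "nat \<Rightarrow> nat \<Rightarrow> nat" where c:
    "\<forall>r<t. \<forall>v<n. c r v < M"
    "\<forall>r<t. \<forall>u<n. \<forall>v<n. {u, v} \<in> G \<longrightarrow> c r u \<noteq> c r v"
    "\<forall>r<t. \<forall>r'<t. r \<noteq> r' \<longrightarrow> (\<forall>u<n. \<forall>v<n. u \<noteq> v \<longrightarrow> c r u = c r v \<longrightarrow> c r' u \<noteq> c r' v)"
    using orthogonal_colorings[OF G \<alpha> rich sparse pos(1-3) M(2)[unfolded M(1)] order_refl]
    unfolding M(1)[symmetric] by (elim exE conjE) (rule that)
  have T: "\<exists>f. tone_coloring n G t (t * M) f"
    using tone_coloring_of_orthogonal[of t n c M G] c by blast
  then show "tau t n G \<le> t * M" unfolding tau_def by (rule Least_le)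
  have "\<exists>f. tone_coloring n G t (tau t n G) f"
    unfolding tau_def using T by (rule LeastI)
  then show "t * n \<le> tau t n G * K" using tone_coloring_lower[OF _ \<alpha> G] by blast
  have X: "\<exists>c. (\<forall>v<n. c v < M) \<and> (\<forall>u<n. \<forall>v<n. {u, v} \<in> G \<longrightarrow> c u \<noteq> c v)"
    using c pos by blast
  then show "chi n G \<le> M" unfolding chi_def by (rule Least_le)
  have "\<exists>c. (\<forall>v<n. c v < chi n G) \<and> (\<forall>u<n. \<forall>v<n. {u, v} \<in> G \<longrightarrow> c u \<noteq> c v)"
    unfolding chi_def using X by (rule LeastI)
  then show "n \<le> chi n G * K" using coloring_lower[OF _ _ \<alpha>] by blast
qed

section \<open>Probabilities of the bad events\<close>

definition edges_on :: "nat set \<Rightarrow> nat set set" where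
  "edges_on S = {e. e \<subseteq> S \<and> card e = 2}"

lemma all_edges_eq: "all_edges n = edges_on {..<n}"
  by (simp add: all_edges_def edges_on_def)

lemma edges_on_mono: "S \<subseteq> T \<Longrightarrow> edges_on S \<subseteq> edges_on T"
  by (auto simp: edges_on_def)

lemma edges_on_Int: "edges_on S \<inter> edges_on T = edges_on (S \<inter> T)"
  by (auto simp: edges_on_def)

lemma finite_edges_on [simp]: "finite S \<Longrightarrow> finite (edges_on S)"
  unfolding edges_on_def by (rule finite_subset[of _ "Pow S"]) auto

lemma card_edges_on: "finite S \<Longrightarrow> card (edges_on S) = card S choose 2"
  unfolding edges_on_def by (rule n_subsets)

lemma indep_iff:
  assumes "G \<subseteq> all_edges n"
  shows "indep G S \<longleftrightarrow> edges_on S \<inter> G = {}"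
proof
  assume "indep G S"
  then show "edges_on S \<inter> G = {}"
    by (auto simp: indep_def edges_on_def card_2_iff)
next
  assume *: "edges_on S \<inter> G = {}"
  show "indep G S" unfolding indep_def
  proof (intro ballI notI)
    fix u v assume uv: "u \<in> S" "v \<in> S" "{u, v} \<in> G"
    then have "card {u, v} = 2" using assms unfolding all_edges_def by blast
    then have "{u, v} \<in> edges_on S" using uv(1,2) by (simp add: edges_on_def)
    then show False using * uv(3) by blast
  qed
qed

lemma prob_UN_le:
  assumes "finite X" "\<And>x. x \<in> X \<Longrightarrow> measure_pmf.prob M (B x) \<le> b x"
  shows "measure_pmf.prob M (\<Union>x\<in>X. B x) \<le> (\<Sum>x\<in>X. b x)"
proof -
  have "measure_pmf.prob M (\<Union>x\<in>X. B x) \<le> (\<Sum>x\<in>X. measure_pmf.prob M (B x))"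
    using assms(1) by (intro measure_pmf.finite_measure_subadditive_finite) auto
  also have "\<dots> \<le> (\<Sum>x\<in>X. b x)" using assms(2) by (rule sum_mono)
  finally show ?thesis .
qed

lemma prob_mono_rsub:
  assumes "\<And>G. G \<subseteq> E \<Longrightarrow> P G \<Longrightarrow> Q G"
  shows "measure_pmf.prob (rsub E p) {G. P G} \<le> measure_pmf.prob (rsub E p) {G. Q G}"
proof (rule measure_pmf.finite_measure_mono_AE)
  show "AE G in measure_pmf (rsub E p). G \<in> {G. P G} \<longrightarrow> G \<in> {G. Q G}"
    using assms set_rsub[of E p] by (simp add: AE_measure_pmf_iff) blast
qed simp

lemma prob_not_small_alpha:
  assumes "0 \<le> p" "p \<le> 1"
  shows "measure_pmf.prob (gnp n p) {G. \<not> small_alpha n K G} \<le> real (n choose K) * (1 - p) ^ (K choose 2)"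
proof -
  let ?X = "{S. S \<subseteq> {..<n} \<and> card S = K}"
  have "measure_pmf.prob (gnp n p) {G. \<not> small_alpha n K G}
      \<le> measure_pmf.prob (gnp n p) {G. G \<in> (\<Union>S\<in>?X. {G. edges_on S \<inter> G = {}})}"
    unfolding gnp_eq_rsub by (rule prob_mono_rsub) (auto simp: small_alpha_def indep_iff)
  also have "\<dots> \<le> (\<Sum>S\<in>?X. (1 - p) ^ (K choose 2))"
    unfolding Collect_mem_eq
  proof (rule prob_UN_le)
    fix S assume S: "S \<in> ?X"
    then have "finite S" using finite_subset by blast
    moreover have "edges_on S \<subseteq> all_edges n" using S by (simp add: all_edges_eq edges_on_mono)
    ultimately show "measure_pmf.prob (gnp n p) {G. edges_on S \<inter> G = {}} \<le> (1 - p) ^ (K choose 2)"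
      using S assms by (simp add: gnp_eq_rsub prob_avoid card_edges_on)
  qed auto
  finally show ?thesis by (simp add: n_subsets)
qed

lemma sum_degrees_le:
  assumes "finite U" "G \<subseteq> all_edges n"
  shows "(\<Sum>v\<in>U. card {u \<in> U. {u, v} \<in> G}) \<le> 2 * card (edges_on U \<inter> G)"
proof -
  have "(\<Sum>v\<in>U. card {u \<in> U. {u, v} \<in> G}) = card (SIGMA v:U. {u \<in> U. {u, v} \<in> G})"
    using assms(1) by simp
  also have "\<dots> \<le> card (\<Union>e\<in>edges_on U \<inter> G. {(v, u). {u, v} = e \<and> card e = 2})"
  proof (rule card_mono)
    have "(\<Union>e\<in>edges_on U \<inter> G. {(v, u). {u, v} = e \<and> card e = 2}) \<subseteq> U \<times> U"
      by (auto simp: edges_on_def)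
    then show "finite (\<Union>e\<in>edges_on U \<inter> G. {(v, u). {u, v} = e \<and> card e = 2})"
      using assms(1) finite_subset by blast
    show "(SIGMA v:U. {u \<in> U. {u, v} \<in> G}) \<subseteq> (\<Union>e\<in>edges_on U \<inter> G. {(v, u). {u, v} = e \<and> card e = 2})"
      using assms(2) by (auto simp: edges_on_def all_edges_def)
  qed
  also have "\<dots> \<le> (\<Sum>e\<in>edges_on U \<inter> G. card {(v, u). {u, v} = e \<and> card e = 2})"
    using assms(1) by (intro card_UN_le) auto
  also have "\<dots> \<le> (\<Sum>e\<in>edges_on U \<inter> G. 2)"
  proof (rule sum_mono)
    fix e assume "e \<in> edges_on U \<inter> G"
    then obtain a b where e: "e = {a, b}" "a \<noteq> b" by (auto simp: edges_on_def card_2_iff)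
    have "card {(v, u). {u, v} = e \<and> card e = 2} \<le> card {(a, b), (b, a)}"
      unfolding e by (rule card_mono) (auto simp: doubleton_eq_iff)
    also have "card {(a, b), (b, a)} = 2" using e(2) by simp
    finally show "card {(v, u). {u, v} = e \<and> card e = 2} \<le> 2" .
  qed
  also have "(\<Sum>e\<in>edges_on U \<inter> G. 2) = 2 * card (edges_on U \<inter> G)" by (simp only: sum_constant mult.commute of_nat_id)
  finally show ?thesis .
qed

lemma sum_Pow_power_card:
  assumes "finite A"
  shows "(\<Sum>U\<in>Pow A. (y :: real) ^ card U) = (1 + y) ^ card A"
proof -
  have "(\<Prod>a\<in>A. 1 + y) = (\<Sum>U\<in>Pow A. (\<Prod>a\<in>U. y) * (\<Prod>a\<in>A - U. 1))"
    using prod_add[OF assms, of "\<lambda>_. y" "\<lambda>_. 1"] by (simp add: add.commute)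
  then show ?thesis by simp
qed

text \<open>Markov's inequality for 2 to the number of edges in \<open>U\<close>. As p m is at most
  d / 8, the mean is at most exp (card U d / 16), while the threshold is 2 to the power card U d /
  2.\<close>

lemma prob_many_edges:
  assumes p: "0 \<le> p" "p \<le> 1" and U: "U \<subseteq> {..<n}" "card U \<le> m" and d: "8 * (p * m) \<le> real d"
  shows "measure_pmf.prob (gnp n p) {G. card U * d \<le> 2 * card (edges_on U \<inter> G)} \<le> exp (- (real d / 4)) ^ card U"
proof -
  let ?E = "all_edges n"
  define a where "a = (2::real) powr (real (card U * d) / 2)"
  have fU: "finite U" using U finite_subset by blast
  have "measure_pmf.prob (gnp n p) {G. card U * d \<le> 2 * card (edges_on U \<inter> G)} * a
      = rexp ?E p (\<lambda>G. indicator {G. card U * d \<le> 2 * card (edges_on U \<inter> G)} G * a)"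
    by (simp add: gnp_eq_rsub)
  also have "\<dots> \<le> rexp ?E p (\<lambda>G. 2 ^ card (edges_on U \<inter> G))"
  proof (rule rexp_mono)
    fix G
    show "indicator {G. card U * d \<le> 2 * card (edges_on U \<inter> G)} G * a \<le> 2 ^ card (edges_on U \<inter> G)"
    proof (cases "card U * d \<le> 2 * card (edges_on U \<inter> G)")
      case True
      then have "real (card U * d) / 2 \<le> real (card (edges_on U \<inter> G))" by linarith
      then have "a \<le> 2 powr real (card (edges_on U \<inter> G))" unfolding a_def by (intro powr_mono) auto
      then show ?thesis using True by (simp add: powr_realpow)
    qed simp
  qed simp
  also have "\<dots> = (1 + p) ^ (card U choose 2)"
    using p fU U by (subst rexp_pow2) (auto simp: card_edges_on all_edges_eq edges_on_mono)
  also have "\<dots> \<le> exp p ^ (card U choose 2)"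
    using p by (intro power_mono) auto
  also have "\<dots> = exp (p * real (card U choose 2))"
    by (simp add: exp_of_nat_mult[symmetric] mult.commute)
  also have "\<dots> \<le> exp (real (card U * d) / 16)"
  proof -
    have "2 * (card U choose 2) = card U * (card U - 1)"
      by (cases "card U") (simp_all add: choose_two)
    then have "real (2 * (card U choose 2)) = real (card U * (card U - 1))" by (rule arg_cong)
    also have "\<dots> \<le> real (card U * m)" using U(2) by (intro of_nat_mono mult_le_mono2) simp
    finally have "p * real (card U choose 2) \<le> p * (real (card U * m) / 2)"
      using p by (intro mult_left_mono) auto
    also have "\<dots> = real (card U) * (8 * (p * m)) / 16" by simp
    also have "\<dots> \<le> real (card U) * real d / 16"
      using d by (intro divide_right_mono mult_left_mono) auto
    finally show ?thesis by simp
  qed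
  finally have *: "measure_pmf.prob (gnp n p) {G. card U * d \<le> 2 * card (edges_on U \<inter> G)} * a
      \<le> exp (real (card U * d) / 16)" .
  have "a = exp (ln 2 * (real (card U * d) / 2))" by (simp add: a_def powr_def mult.commute)
  then have "measure_pmf.prob (gnp n p) {G. card U * d \<le> 2 * card (edges_on U \<inter> G)}
      \<le> exp (real (card U * d) / 16) * exp (- (ln 2 * (real (card U * d) / 2)))"
    using * by (simp add: exp_minus field_simps)
  also have "\<dots> = exp (real (card U * d) * (1 / 16 - ln 2 / 2))"
    by (simp add: exp_add[symmetric] algebra_simps)
  \<comment> \<open>With ln 2 \<ge> 2/3, the difference ln 2 / 2 - 1/16 is at least 13/48, which
    exceeds 1/4.\<close>
  also have "\<dots> \<le> exp (real (card U * d) * (- 1 / 4))"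
    using ln2_ge_two_thirds by (intro iffD2[OF exp_le_cancel_iff] mult_left_mono) auto
  also have "\<dots> = exp (- (real d / 4)) ^ card U"
    by (simp add: exp_of_nat_mult[symmetric])
  finally show ?thesis .
qed

text \<open>If all degrees inside \<open>U\<close> are at least \<open>d\<close>, then
  \<open>U\<close> spans at least card U d / 2 edges. The union bound over \<open>U\<close> is a
  binomial sum, from which the empty set is subtracted.\<close>

lemma prob_not_locally_sparse:
  assumes p: "0 \<le> p" "p \<le> 1" and d: "8 * (p * m) \<le> real d"
  shows "measure_pmf.prob (gnp n p) {G. \<not> locally_sparse n m d G} \<le> (1 + exp (- (real d / 4))) ^ n - 1"
proof -
  let ?X = "{U. U \<subseteq> {..<n} \<and> U \<noteq> {} \<and> card U \<le> m}"
  let ?y = "exp (- (real d / 4))"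
  have fX: "finite ?X" by (rule finite_subset[of _ "Pow {..<n}"]) auto
  have "measure_pmf.prob (gnp n p) {G. \<not> locally_sparse n m d G}
      \<le> measure_pmf.prob (gnp n p) {G. G \<in> (\<Union>U\<in>?X. {G. card U * d \<le> 2 * card (edges_on U \<inter> G)})}"
    unfolding gnp_eq_rsub
  proof (rule prob_mono_rsub)
    fix G assume G: "G \<subseteq> all_edges n" "\<not> locally_sparse n m d G"
    then obtain U where U: "U \<subseteq> {..<n}" "U \<noteq> {}" "card U \<le> m"
        "\<forall>v\<in>U. d \<le> card {u \<in> U. {u, v} \<in> G}"
      unfolding locally_sparse_def by (auto simp: not_less)
    have "card U * d = (\<Sum>v\<in>U. d)" by simp
    also have "\<dots> \<le> (\<Sum>v\<in>U. card {u \<in> U. {u, v} \<in> G})" using U(4) by (intro sum_mono) auto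
    also have "\<dots> \<le> 2 * card (edges_on U \<inter> G)"
      using U(1) G(1) finite_subset by (intro sum_degrees_le) auto
    finally show "G \<in> (\<Union>U\<in>?X. {G. card U * d \<le> 2 * card (edges_on U \<inter> G)})" using U by blast
  qed
  also have "\<dots> \<le> (\<Sum>U\<in>?X. ?y ^ card U)"
    unfolding Collect_mem_eq using fX p d by (intro prob_UN_le prob_many_edges) auto
  also have "\<dots> \<le> (\<Sum>U\<in>Pow {..<n} - {{}}. ?y ^ card U)"
    by (rule sum_mono2) auto
  also have "\<dots> = (1 + ?y) ^ n - 1"
    by (simp add: sum_diff1 sum_Pow_power_card)
  finally show ?thesis .
qed

section \<open>Independent transversals\<close>

lemma card_PiE_const: "finite A \<Longrightarrow> card (PiE A (\<lambda>_. B)) = card B ^ card A"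
  by (simp add: card_PiE)

text \<open>Choose all coordinates except \<open>j\<close> freely; the remaining one is confined to
  a single fibre of \<open>f j\<close>.\<close>

lemma card_transversals_conflict:
  fixes f :: "nat \<Rightarrow> nat \<Rightarrow> nat"
  assumes ij: "i < k" "j < k" "i \<noteq> j"
    and fib: "\<And>a. card {x \<in> {..<s}. f j x = a} \<le> K"
  shows "card {\<phi> \<in> PiE {..<k} (\<lambda>_. {..<s}). f i (\<phi> i) = f j (\<phi> j)} \<le> K * s ^ (k - 1)"
proof -
  let ?P = "PiE ({..<k} - {j}) (\<lambda>_. {..<s})"
  have fP: "finite ?P" by (intro finite_PiE) auto
  let ?S = "SIGMA \<psi>:?P. {x \<in> {..<s}. f j x = f i (\<psi> i)}"
  have "{\<phi> \<in> PiE {..<k} (\<lambda>_. {..<s}). f i (\<phi> i) = f j (\<phi> j)} \<subseteq> (\<lambda>(\<psi>, x). \<psi>(j := x)) ` ?S"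
  proof
    fix \<phi> assume \<phi>: "\<phi> \<in> {\<phi> \<in> PiE {..<k} (\<lambda>_. {..<s}). f i (\<phi> i) = f j (\<phi> j)}"
    let ?\<psi> = "restrict \<phi> ({..<k} - {j})"
    have "\<phi> = ?\<psi>(j := \<phi> j)" using \<phi> ij(2) by (auto simp: fun_eq_iff PiE_def extensional_def)
    moreover have "?\<psi> \<in> ?P" using \<phi> by (auto simp: PiE_def)
    moreover have "?\<psi> i = \<phi> i" using ij by simp
    moreover have "\<phi> j < s" using \<phi> ij(2) by (auto simp: PiE_def Pi_def)
    ultimately show "\<phi> \<in> (\<lambda>(\<psi>, x). \<psi>(j := x)) ` ?S"
      using \<phi> by (intro image_eqI[of _ _ "(?\<psi>, \<phi> j)"]) (simp_all only: prod.case mem_Sigma_iff mem_Collect_eq lessThan_iff conj_assoc simp_thms)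
  qed
  then have "card {\<phi> \<in> PiE {..<k} (\<lambda>_. {..<s}). f i (\<phi> i) = f j (\<phi> j)} \<le> card ((\<lambda>(\<psi>, x). \<psi>(j := x)) ` ?S)"
    using fP by (intro card_mono finite_imageI finite_SigmaI) auto
  also have "\<dots> \<le> card ?S" using fP by (intro card_image_le finite_SigmaI) auto
  also have "\<dots> = (\<Sum>\<psi>\<in>?P. card {x \<in> {..<s}. f j x = f i (\<psi> i)})" using fP by simp
  also have "\<dots> \<le> (\<Sum>\<psi>\<in>?P. K)" using fib by (intro sum_mono) auto
  also have "\<dots> = K * s ^ (k - 1)" using ij(2) by (simp add: card_PiE_const)
  finally show ?thesis .
qed

lemma card_transversals_agree:
  assumes "J \<subseteq> {..<k}" "\<phi> \<in> PiE {..<k} (\<lambda>_. {..<s})"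
  shows "card {\<psi> \<in> PiE {..<k} (\<lambda>_. {..<s}). {i \<in> {..<k}. \<phi> i = \<psi> i} = J} \<le> s ^ (k - card J)"
proof -
  have fJ: "finite J" using assms(1) finite_subset by blast
  have "card {\<psi> \<in> PiE {..<k} (\<lambda>_. {..<s}). {i \<in> {..<k}. \<phi> i = \<psi> i} = J}
      \<le> card (PiE {..<k} (\<lambda>i. if i \<in> J then {\<phi> i} else {..<s}))"
  proof (rule card_mono)
    show "finite (PiE {..<k} (\<lambda>i. if i \<in> J then {\<phi> i} else {..<s}))" by (intro finite_PiE) auto
    show "{\<psi> \<in> PiE {..<k} (\<lambda>_. {..<s}). {i \<in> {..<k}. \<phi> i = \<psi> i} = J}
        \<subseteq> PiE {..<k} (\<lambda>i. if i \<in> J then {\<phi> i} else {..<s})"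
    proof (intro subsetI PiE_I)
      fix \<psi> i assume \<psi>: "\<psi> \<in> {\<psi> \<in> PiE {..<k} (\<lambda>_. {..<s}). {i \<in> {..<k}. \<phi> i = \<psi> i} = J}" "i \<in> {..<k}"
      then have "\<psi> i \<in> {..<s}" "i \<in> J \<longleftrightarrow> \<phi> i = \<psi> i" by auto
      then show "\<psi> i \<in> (if i \<in> J then {\<phi> i} else {..<s})" by simp
    qed auto
  qed
  also have "\<dots> = (\<Prod>i\<in>{..<k}. if i \<in> J then 1 else s)"
    by (subst card_PiE) (auto intro!: prod.cong)
  also have "\<dots> = (\<Prod>i\<in>{..<k} - J. s)"
    by (subst prod.If_cases) (simp_all add: Diff_eq Compl_eq)
  also have "\<dots> = s ^ (k - card J)"
    using assms(1) fJ by (simp add: card_Diff_subset)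
  finally show ?thesis .
qed

lemma sum_Pow_card:
  fixes g :: "nat \<Rightarrow> real"
  assumes "finite A"
  shows "(\<Sum>J\<in>{J \<in> Pow A. 2 \<le> card J}. g (card J)) = (\<Sum>l = 2..card A. real (card A choose l) * g l)"
proof -
  have "(\<Sum>J\<in>{J \<in> Pow A. 2 \<le> card J}. g (card J))
      = (\<Sum>l = 2..card A. \<Sum>J\<in>{J \<in> {J \<in> Pow A. 2 \<le> card J}. card J = l}. g (card J))"
    using assms by (intro sum.group[symmetric]) (auto intro: card_mono)
  also have "\<dots> = (\<Sum>l = 2..card A. real (card A choose l) * g l)"
  proof (rule sum.cong[OF refl])
    fix l assume l: "l \<in> {2..card A}"
    have "{J \<in> {J \<in> Pow A. 2 \<le> card J}. card J = l} = {J. J \<subseteq> A \<and> card J = l}" using l by auto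
    then have "(\<Sum>J\<in>{J \<in> {J \<in> Pow A. 2 \<le> card J}. card J = l}. g (card J))
        = (\<Sum>J\<in>{J. J \<subseteq> A \<and> card J = l}. g l)" by (intro sum.cong) auto
    then show "(\<Sum>J\<in>{J \<in> {J \<in> Pow A. 2 \<le> card J}. card J = l}. g (card J)) = real (card A choose l) * g l"
      using assms by (simp add: n_subsets)
  qed
  finally show ?thesis .
qed

text \<open>
  Janson's inequality is applied to transversals of \<open>k\<close> disjoint parts of size \<open>s\<close> of \<open>W\<close> rather than to
  all \<open>k\<close>-subsets of \<open>W\<close>: the sets on which two transversals agree are easier to count than
  intersections of \<open>k\<close>-sets, and only a constant factor in the size of \<open>W\<close> is lost.
\<close>
lemma prob_no_transversal:
  fixes c :: "nat \<times> nat \<Rightarrow> nat" and \<rho> p :: real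
  assumes p: "0 \<le> p" "p < 1" and W: "W \<subseteq> {..<n}" "k * s \<le> card W"
    and c: "bounded_fibres n K t c"
    and k: "2 \<le> k" "0 < s" and s: "2 * (k * k * t * K) \<le> s"
    and \<rho>: "(\<Sum>l = 2..k. real (k choose l) / real s ^ l / (1 - p) ^ (l choose 2)) \<le> \<rho>"
  shows "measure_pmf.prob (gnp n p)
    {G. \<not> (\<exists>S\<subseteq>W. card S = k \<and> indep G S \<and> (\<forall>r<t. inj_on (\<lambda>v. c (r, v)) S))} \<le> exp (- (1 / (8 * \<rho>)))"
proof -
  define q where "q = 1 - p"
  have q: "0 < q" "q \<le> 1" using p by (auto simp: q_def)
  \<comment> \<open>The injection \<open>e\<close> lays a k by s grid into \<open>W\<close>. Its
    rows are the parts, and a function in \<open>\<Phi>\<close> picks one vertex per row.\<close>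
  have "card ({..<k} \<times> {..<s}) \<le> card W" using W(2) by simp
  moreover have "finite W" using W(1) finite_subset by blast
  ultimately obtain e where e: "inj_on e ({..<k} \<times> {..<s})" "e ` ({..<k} \<times> {..<s}) \<subseteq> W"
    using card_le_inj[of "{..<k} \<times> {..<s}" W] by auto
  define \<Phi> where "\<Phi> = PiE {..<k} (\<lambda>_. {..<s})"
  define S where "S \<phi> = (\<lambda>i. e (i, \<phi> i)) ` {..<k}" for \<phi> :: "nat \<Rightarrow> nat"
  define good where "good = {\<phi> \<in> \<Phi>. \<forall>r<t. inj_on (\<lambda>i. c (r, e (i, \<phi> i))) {..<k}}"
  define C where "C = k choose 2"
  have f\<Phi>: "finite \<Phi>" unfolding \<Phi>_def by (intro finite_PiE) auto
  have c\<Phi>: "card \<Phi> = s ^ k" by (simp add: \<Phi>_def card_PiE_const)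
  have fgood: "finite good" using f\<Phi> by (simp add: good_def)
  have lt: "\<phi> i < s" if "\<phi> \<in> \<Phi>" "i < k" for \<phi> i using that by (auto simp: \<Phi>_def)
  have e_eq: "e (i, \<phi> i) = e (j, \<psi> j) \<longleftrightarrow> i = j \<and> \<phi> i = \<psi> j"
    if "\<phi> \<in> \<Phi>" "\<psi> \<in> \<Phi>" "i < k" "j < k" for \<phi> \<psi> i j
    using inj_on_eq_iff[OF e(1), of "(i, \<phi> i)" "(j, \<psi> j)"] that lt by auto
  have S_W: "S \<phi> \<subseteq> W" if "\<phi> \<in> \<Phi>" for \<phi>
    using e(2) lt[OF that] by (force simp: S_def)
  have card_S: "card (S \<phi>) = k" if "\<phi> \<in> \<Phi>" for \<phi>
    using e_eq[OF that that] by (simp add: S_def card_image inj_on_def)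
  have finS: "finite (S \<phi>)" for \<phi> by (simp add: S_def)
  have card_e: "card (edges_on (S \<phi>)) = C" if "\<phi> \<in> \<Phi>" for \<phi>
    using that by (simp add: C_def card_edges_on card_S finS)
  have card_SS: "card (S \<phi> \<inter> S \<psi>) = card {i \<in> {..<k}. \<phi> i = \<psi> i}" if "\<phi> \<in> \<Phi>" "\<psi> \<in> \<Phi>" for \<phi> \<psi>
  proof -
    have "S \<phi> \<inter> S \<psi> = (\<lambda>i. e (i, \<phi> i)) ` {i \<in> {..<k}. \<phi> i = \<psi> i}"
    proof (intro equalityI subsetI)
      fix x assume "x \<in> S \<phi> \<inter> S \<psi>"
      then obtain i j where ij: "i < k" "j < k" "x = e (i, \<phi> i)" "x = e (j, \<psi> j)" by (auto simp: S_def)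
      then have "i = j" "\<phi> i = \<psi> i" using e_eq[OF that ij(1,2)] by auto
      then show "x \<in> (\<lambda>i. e (i, \<phi> i)) ` {i \<in> {..<k}. \<phi> i = \<psi> i}" using ij by blast
    qed (force simp: S_def)
    moreover have "inj_on (\<lambda>i. e (i, \<phi> i)) {i \<in> {..<k}. \<phi> i = \<psi> i}"
      by (rule inj_onI) (metis (no_types, lifting) e_eq[OF that(1) that(1)] lessThan_iff mem_Collect_eq)
    ultimately show ?thesis by (simp only: card_image)
  qed
  have bad: "card (\<Phi> - good) \<le> k * k * t * (K * s ^ (k - 1))"
  proof -
    let ?I = "{(i, j). i < k \<and> j < k \<and> i \<noteq> j} \<times> {..<t}"
    let ?B = "\<lambda>((i, j), r). {\<phi> \<in> \<Phi>. c (r, e (i, \<phi> i)) = c (r, e (j, \<phi> j))}"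
    have sub: "?I \<subseteq> ({..<k} \<times> {..<k}) \<times> {..<t}" by auto
    then have fI: "finite ?I" by (rule finite_subset) simp
    have "\<Phi> - good \<subseteq> (\<Union>x\<in>?I. ?B x)"
      by (auto simp: good_def inj_on_def) blast
    then have "card (\<Phi> - good) \<le> card (\<Union>x\<in>?I. ?B x)"
      using fI f\<Phi> by (intro card_mono) auto
    also have "\<dots> \<le> (\<Sum>x\<in>?I. card (?B x))" using fI by (rule card_UN_le)
    also have "\<dots> \<le> (\<Sum>x\<in>?I. K * s ^ (k - 1))"
    proof (rule sum_mono)
      fix x assume "x \<in> ?I"
      then obtain i j r where x: "x = ((i, j), r)" "i < k" "j < k" "i \<noteq> j" "r < t" by auto
      have "card {y \<in> {..<s}. c (r, e (j, y)) = a} \<le> K" for a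
      proof -
        have "card {y \<in> {..<s}. c (r, e (j, y)) = a} \<le> card {v \<in> {..<n}. c (r, v) = a}"
        proof (rule card_inj_on_le)
          show "inj_on (\<lambda>y. e (j, y)) {y \<in> {..<s}. c (r, e (j, y)) = a}"
            using e(1) x(3) by (auto simp: inj_on_def)
          show "(\<lambda>y. e (j, y)) ` {y \<in> {..<s}. c (r, e (j, y)) = a} \<subseteq> {v \<in> {..<n}. c (r, v) = a}"
            using e(2) W(1) x(3) by fastforce
        qed simp
        then show ?thesis using c x(5) unfolding bounded_fibres_def by (meson order_trans)
      qed
      then show "card (?B x) \<le> K * s ^ (k - 1)"
        using card_transversals_conflict[OF x(2-4), of s "\<lambda>i y. c (r, e (i, y))" K]
        by (simp add: x(1) \<Phi>_def)
    qed
    also have "\<dots> = card ?I * (K * s ^ (k - 1))" by simp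
    also have "\<dots> \<le> k * k * t * (K * s ^ (k - 1))"
      using card_mono[OF _ sub] by (intro mult_le_mono1) (simp add: mult.assoc)
    finally show ?thesis .
  qed
  \<comment> \<open>Here \<open>s\<close> has to dominate the class sizes: conflicts spoil at most
    half of the transversals.\<close>
  have good_half: "s ^ k \<le> 2 * card good"
  proof -
    have sk: "s ^ k = s * s ^ (k - 1)" using k by (simp add: power_eq_if)
    have "2 * (k * k * t * (K * s ^ (k - 1))) = 2 * (k * k * t * K) * s ^ (k - 1)" by simp
    also have "\<dots> \<le> s ^ k" unfolding sk using s by (rule mult_le_mono1)
    finally have "2 * card (\<Phi> - good) \<le> s ^ k" using bad by linarith
    moreover have "card (\<Phi> - good) = s ^ k - card good"
      using c\<Phi> fgood by (subst card_Diff_subset) (auto simp: good_def)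
    ultimately show ?thesis by linarith
  qed
  \<comment> \<open>Two transversals share a possible edge only if they agree in at least two rows.
    Grouped by the set \<open>J\<close> of rows of agreement, an overlap in l rows saves l choose 2
    of the required non-edges.\<close>
  have inner: "(\<Sum>\<psi>\<in>{\<psi> \<in> \<Phi>. edges_on (S \<phi>) \<inter> edges_on (S \<psi>) \<noteq> {}}. q ^ card (edges_on (S \<phi>) \<union> edges_on (S \<psi>)))
      \<le> q ^ (2 * C) * real s ^ k * \<rho>" if \<phi>: "\<phi> \<in> \<Phi>" for \<phi>
  proof -
    define I where "I \<psi> = {i \<in> {..<k}. \<phi> i = \<psi> i}" for \<psi>
    define g where "g l = q ^ (2 * C) / q ^ (l choose 2)" for l
    have g0: "g l \<ge> 0" for l using q by (simp add: g_def)
    have int: "card (edges_on (S \<phi>) \<inter> edges_on (S \<psi>)) = card (I \<psi>) choose 2" if "\<psi> \<in> \<Phi>" for \<psi>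
      using card_SS[OF \<phi> that] finS by (simp add: edges_on_Int card_edges_on I_def)
    have un: "q ^ card (edges_on (S \<phi>) \<union> edges_on (S \<psi>)) = g (card (I \<psi>))" if \<psi>: "\<psi> \<in> \<Phi>" for \<psi>
    proof -
      have "card (edges_on (S \<phi>) \<union> edges_on (S \<psi>)) + (card (I \<psi>) choose 2) = 2 * C"
        using card_Un_Int[of "edges_on (S \<phi>)" "edges_on (S \<psi>)"] int[OF \<psi>] finS card_e \<phi> \<psi> by simp
      then have "q ^ card (edges_on (S \<phi>) \<union> edges_on (S \<psi>)) * q ^ (card (I \<psi>) choose 2) = q ^ (2 * C)"
        by (metis power_add)
      then show ?thesis using q by (simp add: g_def field_simps)
    qed
    have "(\<Sum>\<psi>\<in>{\<psi> \<in> \<Phi>. edges_on (S \<phi>) \<inter> edges_on (S \<psi>) \<noteq> {}}. q ^ card (edges_on (S \<phi>) \<union> edges_on (S \<psi>)))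
        = (\<Sum>\<psi>\<in>{\<psi> \<in> \<Phi>. edges_on (S \<phi>) \<inter> edges_on (S \<psi>) \<noteq> {}}. g (card (I \<psi>)))"
      using un by (intro sum.cong) auto
    also have "\<dots> \<le> (\<Sum>\<psi>\<in>{\<psi> \<in> \<Phi>. 2 \<le> card (I \<psi>)}. g (card (I \<psi>)))"
    proof (rule sum_mono2)
      show "{\<psi> \<in> \<Phi>. edges_on (S \<phi>) \<inter> edges_on (S \<psi>) \<noteq> {}} \<subseteq> {\<psi> \<in> \<Phi>. 2 \<le> card (I \<psi>)}"
      proof (clarify, rule ccontr)
        fix \<psi> assume *: "\<psi> \<in> \<Phi>" "edges_on (S \<phi>) \<inter> edges_on (S \<psi>) \<noteq> {}" "\<not> 2 \<le> card (I \<psi>)"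
        then have "card (edges_on (S \<phi>) \<inter> edges_on (S \<psi>)) = 0"
          by (simp add: int binomial_eq_0)
        then show False using *(2) finS by simp
      qed
    qed (use f\<Phi> g0 in auto)
    also have "\<dots> = (\<Sum>J\<in>{J \<in> Pow {..<k}. 2 \<le> card J}. \<Sum>\<psi>\<in>{\<psi> \<in> {\<psi> \<in> \<Phi>. 2 \<le> card (I \<psi>)}. I \<psi> = J}. g (card (I \<psi>)))"
      using f\<Phi> by (intro sum.group[symmetric]) (auto simp: I_def)
    also have "\<dots> \<le> (\<Sum>J\<in>{J \<in> Pow {..<k}. 2 \<le> card J}. real s ^ (k - card J) * g (card J))"
    proof (rule sum_mono)
      fix J assume J: "J \<in> {J \<in> Pow {..<k}. 2 \<le> card J}"
      have "(\<Sum>\<psi>\<in>{\<psi> \<in> {\<psi> \<in> \<Phi>. 2 \<le> card (I \<psi>)}. I \<psi> = J}. g (card (I \<psi>)))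
          = (\<Sum>\<psi>\<in>{\<psi> \<in> \<Phi>. I \<psi> = J}. g (card J))"
        using J by (intro sum.cong) auto
      also have "\<dots> = real (card {\<psi> \<in> \<Phi>. I \<psi> = J}) * g (card J)" by simp
      also have "\<dots> \<le> real (s ^ (k - card J)) * g (card J)"
        using card_transversals_agree[of J k \<phi> s] J \<phi> g0
        by (intro mult_right_mono of_nat_mono) (auto simp: I_def \<Phi>_def)
      finally show "(\<Sum>\<psi>\<in>{\<psi> \<in> {\<psi> \<in> \<Phi>. 2 \<le> card (I \<psi>)}. I \<psi> = J}. g (card (I \<psi>)))
          \<le> real s ^ (k - card J) * g (card J)" by simp
    qed
    also have "\<dots> = (\<Sum>l = 2..k. real (k choose l) * (real s ^ (k - l) * g l))"
      using sum_Pow_card[of "{..<k}" "\<lambda>l. real s ^ (k - l) * g l"] by simp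
    also have "\<dots> = (\<Sum>l = 2..k. q ^ (2 * C) * real s ^ k * (real (k choose l) / real s ^ l / q ^ (l choose 2)))"
      using k(2) by (intro sum.cong refl) (simp add: g_def power_diff)
    also have "\<dots> \<le> q ^ (2 * C) * real s ^ k * \<rho>"
      unfolding sum_distrib_left[symmetric] using \<rho> q by (intro mult_left_mono) (auto simp: q_def)
    finally show ?thesis .
  qed
  define \<mu> where "\<mu> = (\<Sum>\<phi>\<in>good. (1 - p) ^ card (edges_on (S \<phi>)))"
  define \<Delta> where "\<Delta> = (\<Sum>\<phi>\<in>good. \<Sum>\<psi>\<in>{\<psi> \<in> good. edges_on (S \<phi>) \<inter> edges_on (S \<psi>) \<noteq> {}}.
    (1 - p) ^ card (edges_on (S \<phi>) \<union> edges_on (S \<psi>)))"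
  \<comment> \<open>\<open>a\<close> is the expected number of independent transversals when
    \<open>c\<close> is ignored. The good ones give \<mu> \<ge> a / 2, while \<Delta> is bounded
    through all transversals by \<rho> a^2; the quotient \<mu>^2 / (2 \<Delta>) is then at least 1 /
    (8 \<rho>).\<close>
  define a where "a = q ^ C * real s ^ k"
  have a: "a > 0" using q k by (simp add: a_def)
  have "\<mu> = (\<Sum>\<phi>\<in>good. q ^ C)"
    unfolding \<mu>_def q_def[symmetric] by (intro sum.cong refl) (auto simp: good_def card_e)
  then have "\<mu> = real (card good) * q ^ C" by simp
  moreover have "real (s ^ k) \<le> real (2 * card good)" using good_half by (rule of_nat_mono)
  ultimately have \<mu>: "\<mu> \<ge> a / 2" using q by (simp add: a_def)
  have "\<Delta> \<le> (\<Sum>\<phi>\<in>\<Phi>. q ^ (2 * C) * real s ^ k * \<rho>)"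
  proof -
    have "\<Delta> \<le> (\<Sum>\<phi>\<in>good. \<Sum>\<psi>\<in>{\<psi> \<in> \<Phi>. edges_on (S \<phi>) \<inter> edges_on (S \<psi>) \<noteq> {}}. q ^ card (edges_on (S \<phi>) \<union> edges_on (S \<psi>)))"
      unfolding \<Delta>_def q_def[symmetric] using q f\<Phi>
      by (intro sum_mono sum_mono2) (auto simp: good_def)
    also have "\<dots> \<le> (\<Sum>\<phi>\<in>\<Phi>. \<Sum>\<psi>\<in>{\<psi> \<in> \<Phi>. edges_on (S \<phi>) \<inter> edges_on (S \<psi>) \<noteq> {}}. q ^ card (edges_on (S \<phi>) \<union> edges_on (S \<psi>)))"
      using q f\<Phi> by (intro sum_mono2) (auto simp: good_def intro!: sum_nonneg)
    also have "\<dots> \<le> (\<Sum>\<phi>\<in>\<Phi>. q ^ (2 * C) * real s ^ k * \<rho>)" using inner by (intro sum_mono)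
    finally show ?thesis .
  qed
  then have \<Delta>: "\<Delta> \<le> \<rho> * a\<^sup>2"
    by (simp add: c\<Phi> a_def power_mult_distrib power_mult mult_ac power2_eq_square)
  have \<Delta>0: "\<Delta> > 0"
  proof -
    have "real (s ^ k) > 0" using k by simp
    then have "good \<noteq> {}" using good_half by (intro notI) simp
    then obtain \<phi> where \<phi>: "\<phi> \<in> good" by blast
    then have "\<phi> \<in> \<Phi>" by (simp add: good_def)
    then have "card (edges_on (S \<phi>)) > 0" using k card_e by (simp add: C_def)
    then have ne: "edges_on (S \<phi>) \<inter> edges_on (S \<phi>) \<noteq> {}" by auto
    have "0 < (\<Sum>\<psi>\<in>{\<psi> \<in> good. edges_on (S \<phi>) \<inter> edges_on (S \<psi>) \<noteq> {}}. (1 - p) ^ card (edges_on (S \<phi>) \<union> edges_on (S \<psi>)))"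
      using \<phi> ne fgood p by (intro sum_pos2[of _ \<phi>]) auto
    then show ?thesis unfolding \<Delta>_def
      using fgood \<phi> p by (intro sum_pos2[of _ \<phi>]) (auto intro!: sum_nonneg)
  qed
  have \<rho>0: "\<rho> > 0" using \<Delta> \<Delta>0 a by (smt (verit) mult_nonpos_nonneg zero_le_power2)
  have "measure_pmf.prob (gnp n p)
      {G. \<not> (\<exists>S\<subseteq>W. card S = k \<and> indep G S \<and> (\<forall>r<t. inj_on (\<lambda>v. c (r, v)) S))}
      \<le> measure_pmf.prob (gnp n p) {G. \<forall>\<phi>\<in>good. edges_on (S \<phi>) \<inter> G \<noteq> {}}"
    unfolding gnp_eq_rsub
  proof (rule prob_mono_rsub, intro ballI notI)
    fix G \<phi> assume G: "G \<subseteq> all_edges n" "edges_on (S \<phi>) \<inter> G = {}" and \<phi>: "\<phi> \<in> good"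
      and none: "\<not> (\<exists>S\<subseteq>W. card S = k \<and> indep G S \<and> (\<forall>r<t. inj_on (\<lambda>v. c (r, v)) S))"
    have \<phi>': "\<phi> \<in> \<Phi>" using \<phi> by (simp add: good_def)
    have "inj_on (\<lambda>v. c (r, v)) (S \<phi>)" if "r < t" for r
      using \<phi> that unfolding good_def S_def by (auto simp: inj_on_def)
    then show False using none S_W[OF \<phi>'] card_S[OF \<phi>'] G indep_iff[OF G(1)] by blast
  qed
  also have "\<dots> \<le> exp (- (\<mu>\<^sup>2 / (2 * \<Delta>)))"
    unfolding gnp_eq_rsub
  proof (rule janson[OF _ _ _ fgood _ \<mu>_def \<Delta>_def \<Delta>0])
    fix \<phi> assume "\<phi> \<in> good"
    then have "S \<phi> \<subseteq> {..<n}" using S_W W(1) by (auto simp: good_def)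
    then show "edges_on (S \<phi>) \<subseteq> all_edges n" by (simp add: all_edges_eq edges_on_mono)
  qed (use p in auto)
  also have "\<dots> \<le> exp (- (1 / (8 * \<rho>)))"
  proof -
    have "1 / (8 * \<rho>) = (a / 2)\<^sup>2 / (2 * (\<rho> * a\<^sup>2))" using a \<rho>0 by (simp add: power2_eq_square)
    also have "\<dots> \<le> \<mu>\<^sup>2 / (2 * \<Delta>)"
      using \<mu> \<Delta> \<Delta>0 a by (intro frac_le power_mono) auto
    finally show ?thesis by simp
  qed
  finally show ?thesis .
qed

text \<open>Union bound over at most 2^n sets \<open>W\<close> and n^(t n) families of colourings,
  all fixed before the graph is drawn.\<close>

lemma prob_not_rich:
  fixes \<rho> p :: real
  assumes p: "0 \<le> p" "p < 1" 
    and k: "2 \<le> k" "0 < s" and s: "2 * (k * k * t * K) \<le> s"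
    and \<rho>: "(\<Sum>l = 2..k. real (k choose l) / real s ^ l / (1 - p) ^ (l choose 2)) \<le> \<rho>"
  shows "measure_pmf.prob (gnp n p) {G. \<not> rich n t K k (k * s) G}
    \<le> 2 ^ n * real n ^ (t * n) * exp (- (1 / (8 * \<rho>)))"
proof -
  let ?X = "{W. W \<subseteq> {..<n} \<and> k * s \<le> card W} \<times> {c \<in> PiE ({..<t} \<times> {..<n}) (\<lambda>_. {..<n}). bounded_fibres n K t c}"
  let ?B = "\<lambda>(W, c). {G. \<not> (\<exists>S\<subseteq>W. card S = k \<and> indep G S \<and> (\<forall>r<t. inj_on (\<lambda>v. c (r, v)) S))}"
  let ?Y = "Pow {..<n} \<times> PiE ({..<t} \<times> {..<n}) (\<lambda>_. {..<n})"
  have fY: "finite ?Y" by (intro finite_SigmaI finite_PiE) auto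
  have sub: "?X \<subseteq> ?Y" by auto
  have fX: "finite ?X" using sub fY by (rule finite_subset)
  have "{G. \<not> rich n t K k (k * s) G} = (\<Union>x\<in>?X. ?B x)"
    unfolding rich_def by auto
  then have "measure_pmf.prob (gnp n p) {G. \<not> rich n t K k (k * s) G} = measure_pmf.prob (gnp n p) (\<Union>x\<in>?X. ?B x)"
    by simp
  also have "\<dots> \<le> (\<Sum>x\<in>?X. exp (- (1 / (8 * \<rho>))))"
    using prob_no_transversal[OF p _ _ _ k s \<rho>] by (intro prob_UN_le fX) auto
  also have "\<dots> = real (card ?X) * exp (- (1 / (8 * \<rho>)))" by simp
  also have "\<dots> \<le> real (card ?Y) * exp (- (1 / (8 * \<rho>)))"
    using card_mono[OF fY sub] by (intro mult_right_mono of_nat_mono) auto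
  also have "real (card ?Y) = 2 ^ n * real n ^ (t * n)"
    by (simp add: card_cartesian_product card_PiE_const card_Pow)
  finally show ?thesis .
qed

section \<open>Asymptotic estimates\<close>

text \<open>Compare the \<open>K\<close>-th term in the expansion of (1 + K/n)^n with the bound exp
  K for the whole sum.\<close>

lemma binomial_le_exp_power:
  assumes "0 < K" "0 < n"
  shows "real (n choose K) \<le> (exp 1 * real n / real K) ^ K"
proof (cases "K \<le> n")
  case True
  let ?x = "real K / real n"
  have "real (n choose K) * ?x ^ K \<le> (\<Sum>i\<le>n. real (n choose i) * ?x ^ i * 1 ^ (n - i))"
    using True by (intro order_trans[OF _ member_le_sum[of K]]) auto
  also have "\<dots> = (?x + 1) ^ n" by (rule binomial_ring[symmetric])
  also have "\<dots> \<le> exp ?x ^ n"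
    using exp_ge_add_one_self[of ?x] by (intro power_mono) (auto simp: add.commute)
  also have "\<dots> = exp 1 ^ K"
    using assms(2) by (simp add: exp_of_nat_mult[symmetric])
  finally show ?thesis using assms by (simp add: power_divide power_mult_distrib field_simps)
next
  case False
  then show ?thesis by (simp add: binomial_eq_0)
qed

text \<open>Written as a \<open>j\<close>-th power so that it merges with
  \<open>binomial_le_exp_power\<close> into one base raised to \<open>j\<close>.\<close>

lemma power_choose_two_exp:
  fixes q :: real
  assumes "0 < q"
  shows "q ^ (j choose 2) = exp (ln q * (real j - 1) / 2) ^ j"
proof -
  have "2 * (j choose 2) = j * (j - 1)"
    by (cases j) (simp_all add: choose_two)
  then have "2 * real (j choose 2) = real j * real (j - 1)"
    by (metis of_nat_mult of_nat_numeral)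
  then have "real (j choose 2) = real j * (real j - 1) / 2"
    by (cases j) (auto simp: of_nat_diff)
  then have "real (j choose 2) * ln q = real j * (ln q * (real j - 1) / 2)"
    by (simp only:) (simp add: mult_ac)
  moreover have "q ^ (j choose 2) = exp (real (j choose 2) * ln q)"
    using assms by (simp add: exp_of_nat_mult)
  ultimately show ?thesis
    by (simp only: exp_of_nat_mult[symmetric])
qed

text \<open>
  The estimates have to be uniform in \<open>p\<close>, so the hypotheses \<open>h1\<close> to \<open>h9\<close>, which say that \<open>n\<close> is large,
  do not mention \<open>p\<close>.
\<close>
locale regime =
  fixes n t \<Lambda> :: nat and p \<epsilon> \<eta> :: real
  fixes l \<beta> A B :: real
  defines "l \<equiv> ln (real n)" and "\<beta> \<equiv> 1 / (1 - \<epsilon>)"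
    and "A \<equiv> 2 * \<beta> * exp (\<beta> / 2)" and "B \<equiv> real \<Lambda> * \<beta> ^ (\<Lambda> * \<Lambda>) + 1"
  assumes t: "1 \<le> t" and eps: "\<epsilon> < 1" and eta: "0 < \<eta>" "\<eta> \<le> 1/4" and Lam: "12 \<le> \<eta> * real \<Lambda>"
    and p_lo: "real n powr (-1/4) * l powr (9/4) \<le> p" and p_hi: "p < \<epsilon>"
    and h1: "1 \<le> l" and h2: "8 * \<beta> \<le> 3 * l * \<eta>" and h3: "2 * l\<^sup>2 \<le> \<eta> * real n powr (3/4)"
    and h4: "A \<le> real n powr (3/4 * \<eta>)"
    and h5: "128 * B * (real t + 2) \<le> \<eta>\<^sup>2 * l\<^sup>2" and h6: "48 * real t \<le> \<eta> * l ^ 4"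
    and h7: "2 * exp 1 * l\<^sup>2 \<le> \<eta> * real n powr (\<eta> / 4)"
    and h8: "4 * exp 2 * l ^ 3 \<le> \<eta> * real n powr (1/4)"
    and h9: "12 * real t * l\<^sup>2 \<le> \<eta> * real n powr (1/2)"
begin

text \<open>\<open>x / L\<close> is the logarithm of n p to base 1 / (1 - p), so \<open>K\<close>
  and \<open>k\<close> lie just above and just below twice that value. Since k \<le> 2 l / p, the
  choice of \<open>s\<close> makes the remainder threshold k s at most 2 \<eta> n / l, and
  \<open>d\<close> is 8 p times this bound, as \<open>prob_many_edges\<close> requires. Thus K d is
  only of order \<eta> n.\<close>

definition "L = - ln (1 - p)"
definition "x = ln (real n * p)"
definition "K = nat \<lceil>2 * (1 + \<eta>) * (x / L)\<rceil>"
definition "k = nat \<lfloor>2 * (1 - \<eta>) * (x / L)\<rfloor>"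
definition "s = nat \<lfloor>\<eta> * real n * p / l\<^sup>2\<rfloor>"
definition "d = nat \<lceil>16 * \<eta> * real n * p / l\<rceil>"
definition "M = n div k + (d + t * K)"

section \<open>Elementary bounds on the parameters\<close>

lemma n_pos: "1 < real n"
proof -
  have "n \<noteq> 0" using h1 by (intro notI) (simp add: l_def)
  then show ?thesis using h1 by (simp add: l_def) (metis ln_one not_less_iff_gr_or_eq One_nat_def less_one nat_neq_iff of_nat_1 not_one_le_zero)
qed

lemma n_exp: "real n = exp l"
  using n_pos by (simp add: l_def)

lemma n_powr: "real n powr a = exp (a * l)"
  using n_pos by (simp add: powr_def l_def)

lemma p_ge: "exp (- l / 4) \<le> p"
proof -
  have "exp (- l / 4) * 1 \<le> real n powr (-1/4) * l powr (9/4)"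
    unfolding n_powr using h1 by (intro mult_mono) (auto simp: ge_one_powr_ge_zero)
  then show ?thesis using p_lo by simp
qed

lemma p_pos: "0 < p"
  using p_ge exp_gt_zero less_le_trans by blast

lemma p_lt_1: "p < 1"
  using p_hi eps by simp

lemma beta_gt_1: "1 < \<beta>"
  using p_pos p_hi eps by (simp add: \<beta>_def)

text \<open>The lower bound on \<open>p\<close> with its logarithms, for \<open>k_K_s\<close> and
  \<open>rich_bound\<close>; the other estimates get by with the weaker \<open>p_ge\<close>.\<close>

lemma np4: "l ^ 9 \<le> real n * p ^ 4"
proof -
  have "(real n powr (-1/4) * l powr (9/4)) ^ 4 \<le> p ^ 4"
    using p_lo by (intro power_mono) auto
  moreover have "(real n powr (-1/4) * l powr (9/4)) ^ 4 = real n powr (- 1) * l powr 9"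
    using n_pos h1 by (simp add: power_mult_distrib powr_power)
  moreover have "l powr 9 = l ^ 9" using h1 by (simp add: powr_numeral)
  ultimately have "real n powr (- 1) * l ^ 9 \<le> p ^ 4" by simp
  then show ?thesis using n_pos by (simp add: powr_minus field_simps)
qed

lemma np_ge: "exp (3/4 * l) \<le> real n * p"
proof -
  have "exp l * exp (- l / 4) \<le> real n * p"
    unfolding n_exp using p_ge by (intro mult_left_mono) auto
  then show ?thesis by (simp add: exp_add[symmetric])
qed

lemma np2_ge: "exp (1/2 * l) \<le> real n * p\<^sup>2"
proof -
  have "exp (3/4 * l) * exp (- l / 4) \<le> (real n * p) * p"
    using p_ge np_ge p_pos by (intro mult_mono) auto
  then show ?thesis by (simp add: exp_add[symmetric] power2_eq_square mult.assoc)
qed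

lemma x_bounds: "3/4 * l \<le> x" "x \<le> l"
proof -
  have "0 < real n * p" using n_pos p_pos by simp
  then show "3/4 * l \<le> x" 
    using np_ge iffD2[OF ln_le_cancel_iff, of "exp (3/4 * l)" "real n * p"] unfolding x_def by simp
  have "real n * p \<le> real n" using n_pos p_lt_1 by simp
  then show "x \<le> l" using \<open>0 < real n * p\<close> n_pos unfolding x_def l_def by simp
qed

lemma np_exp: "real n * p = exp x"
  using n_pos p_pos by (simp add: x_def)

text \<open>The distance of \<open>\<epsilon>\<close> from 1 enters through \<open>\<beta>\<close>
  and keeps \<open>L\<close> comparable to \<open>p\<close>.\<close>

lemma L_bounds: "p \<le> L" "L \<le> \<beta> * p"
proof -
  show "p \<le> L" using ln_le_minus_one[of "1 - p"] p_lt_1 by (simp add: L_def)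
  have "L = ln (1 / (1 - p))" using p_lt_1 by (simp add: L_def ln_div)
  also have "\<dots> \<le> 1 / (1 - p) - 1" using p_lt_1 by (intro ln_le_minus_one) simp
  also have "\<dots> = 1 / (1 - p) * p" using p_lt_1 by (simp add: field_simps)
  also have "\<dots> \<le> \<beta> * p"
    unfolding \<beta>_def using p_lt_1 p_hi p_pos eps by (intro mult_right_mono divide_left_mono) auto
  finally show "L \<le> \<beta> * p" .
qed

lemma L_pos: "0 < L" using L_bounds p_pos by linarith

text \<open>The second bound lets the roundings in \<open>K\<close> and \<open>k\<close> cost at
  most \<eta> x / L. The worst case is constant \<open>p\<close>, where x / L is only of order
  l.\<close>

lemma r_bounds: "x / L \<le> l / p" "2 \<le> \<eta> * (x / L)" "8 \<le> x / L"
proof -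
  show "x / L \<le> l / p" using x_bounds L_bounds p_pos h1 by (intro frac_le) auto
  have "2 \<le> \<eta> * (3/4 * l / \<beta>)" using h2 beta_gt_1 by (simp add: field_simps)
  also have "3/4 * l / \<beta> \<le> x / L"
  proof (rule frac_le)
    have "\<beta> * p \<le> \<beta> * 1" using beta_gt_1 p_lt_1 by (intro mult_left_mono) auto
    then show "L \<le> \<beta>" using L_bounds(2) by linarith
  qed (use x_bounds h1 L_pos in auto)
  finally show *: "2 \<le> \<eta> * (x / L)" using eta by (simp add: mult_left_mono)
  have "0 \<le> x / L" using x_bounds h1 L_pos by simp
  then have "\<eta> * (x / L) \<le> 1/4 * (x / L)" using eta by (intro mult_right_mono) auto
  then show "8 \<le> x / L" using * by linarith
qed

lemma K_bounds: "2 * (1 + \<eta>) * (x / L) \<le> K" "K \<le> (2 + 3 * \<eta>) * (x / L)" "K \<le> 3 * l / p" "16 \<le> K"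
proof -
  define r where "r = x / L"
  have r: "r \<le> l / p" "2 \<le> \<eta> * r" "8 \<le> r" using r_bounds by (auto simp: r_def)
  have "0 \<le> 2 * (1 + \<eta>) * r" using r eta by simp
  then show 1: "2 * (1 + \<eta>) * (x / L) \<le> K"
    unfolding K_def r_def[symmetric] by linarith
  have "real K \<le> 2 * (1 + \<eta>) * r + 1" using \<open>0 \<le> 2 * (1 + \<eta>) * r\<close>
    unfolding K_def r_def[symmetric] by linarith
  also have "\<dots> \<le> (2 + 3 * \<eta>) * r" using r(2) by (simp add: algebra_simps)
  finally show "K \<le> (2 + 3 * \<eta>) * (x / L)" by (simp add: r_def)
  also have "\<dots> \<le> 3 * (x / L)" using eta r(3) by (intro mult_right_mono) (auto simp: r_def)
  also have "\<dots> \<le> 3 * l / p" using r(1) by (simp add: r_def)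
  finally show "K \<le> 3 * l / p" .
  have "2 * 8 \<le> 2 * (1 + \<eta>) * r" using r eta by (intro mult_mono) auto
  then show "16 \<le> K" using 1 unfolding r_def by linarith
qed

lemma k_bounds: "real k \<le> 2 * (1 - \<eta>) * (x / L)" "(2 - 3 * \<eta>) * (x / L) \<le> k" "k \<le> 2 * l / p" "2 \<le> k"
proof -
  define r where "r = x / L"
  have r: "r \<le> l / p" "2 \<le> \<eta> * r" "8 \<le> r" using r_bounds by (auto simp: r_def)
  have "0 \<le> 2 * (1 - \<eta>) * r" using r eta by simp
  then show 1: "real k \<le> 2 * (1 - \<eta>) * (x / L)"
    unfolding k_def r_def[symmetric] by linarith
  have "(2 - 3 * \<eta>) * r \<le> 2 * (1 - \<eta>) * r - 1" using r(2) by (simp add: algebra_simps)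
  also have "\<dots> \<le> real k" unfolding k_def r_def[symmetric] by linarith
  finally show 2: "(2 - 3 * \<eta>) * (x / L) \<le> k" by (simp add: r_def)
  have "2 * (1 - \<eta>) * r \<le> 2 * r" using r(3) eta by (intro mult_right_mono) auto
  then show "k \<le> 2 * l / p" using 1 r(1) unfolding r_def[symmetric] by simp
  have "1 * 8 \<le> (2 - 3 * \<eta>) * r" using r eta by (intro mult_mono) auto
  then show "2 \<le> k" using 2 unfolding r_def[symmetric] by linarith
qed

lemma s_bounds: "real s \<le> \<eta> * real n * p / l\<^sup>2" "\<eta> * real n * p / (2 * l\<^sup>2) \<le> s"
proof -
  define y where "y = \<eta> * real n * p / l\<^sup>2"
  have "2 * l\<^sup>2 \<le> \<eta> * (real n * p)"
    using h3 np_ge eta by (smt (verit) mult_left_mono n_powr)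
  then have y: "2 \<le> y" using h1 unfolding y_def by (simp add: field_simps)
  then show "real s \<le> \<eta> * real n * p / l\<^sup>2" unfolding s_def y_def[symmetric] by linarith
  have "y / 2 \<le> real s" using y unfolding s_def y_def[symmetric] by linarith
  then show "\<eta> * real n * p / (2 * l\<^sup>2) \<le> s" by (simp add: y_def)
qed

lemma s_pos: "0 < real s"
proof -
  have "0 < \<eta> * real n * p / (2 * l\<^sup>2)" using eta n_pos p_pos h1 by simp
  then show ?thesis using s_bounds(2) by linarith
qed

lemma d_bounds: "16 * \<eta> * real n * p / l \<le> d" "d \<le> 16 * \<eta> * real n * p / l + 1"
proof -
  have "0 \<le> 16 * \<eta> * real n * p / l" using eta n_pos p_pos h1 by simp
  then show "16 * \<eta> * real n * p / l \<le> d" "d \<le> 16 * \<eta> * real n * p / l + 1"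
    unfolding d_def by linarith+
qed

section \<open>Numerical bounds for sparsity and the independence number\<close>

lemma m_d: "8 * (p * real (k * s)) \<le> real d"
proof -
  have "real k * real s \<le> (2 * l / p) * (\<eta> * real n * p / l\<^sup>2)"
    using k_bounds(3) s_bounds(1) h1 p_pos by (intro mult_mono) auto
  also have "\<dots> = 2 * \<eta> * real n / l" using h1 p_pos by (simp add: power2_eq_square)
  finally have "8 * (p * (real k * real s)) \<le> 8 * (p * (2 * \<eta> * real n / l))"
    using p_pos by (intro mult_left_mono) auto
  then show ?thesis using d_bounds(1) by (simp add: mult_ac)
qed

text \<open>Since d / 4 \<ge> 2 l, the exponential is at most n^(-2), and (1 + n^(-2))^n exceeds 1
  by about 1 / n.\<close>

lemma sparse_bound: "(1 + exp (- (real d / 4))) ^ n - 1 \<le> 2 / real n"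
proof -
  have "l\<^sup>2 \<le> \<eta> * (real n * p)"
  proof -
    have "2 * l\<^sup>2 \<le> \<eta> * (real n * p)"
      using h3 np_ge eta by (smt (verit) mult_left_mono n_powr)
    then show ?thesis by (smt (verit) zero_le_power2)
  qed
  then have "l \<le> \<eta> * (real n * p) / l" using h1 by (simp add: field_simps power2_eq_square)
  moreover have "16 * \<eta> * real n * p / l = 16 * (\<eta> * (real n * p) / l)" by simp
  ultimately have "2 * l \<le> real d / 4" using d_bounds(1) h1 by linarith
  then have "exp (- (real d / 4)) \<le> exp (- 2 * l)" by simp
  also have "\<dots> = 1 / (real n * real n)" unfolding n_exp by (simp add: exp_add[symmetric] exp_minus inverse_eq_divide)
  finally have y: "exp (- (real d / 4)) \<le> 1 / (real n * real n)" .
  have "(1 + exp (- (real d / 4))) ^ n \<le> exp (exp (- (real d / 4))) ^ n"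
    by (intro power_mono) auto
  also have "\<dots> = exp (real n * exp (- (real d / 4)))" by (simp add: exp_of_nat_mult)
  also have "\<dots> \<le> exp (1 / real n)"
    using mult_left_mono[OF y, of "real n"] n_pos by simp
  also have "\<dots> \<le> 1 + 1 / real n + (1 / real n)\<^sup>2" using n_pos by (intro exp_bound) auto
  also have "(1 / real n)\<^sup>2 \<le> 1 / real n * 1"
    unfolding power2_eq_square using n_pos by (intro mult_left_mono) auto
  finally show ?thesis by (simp add: field_simps)
qed

text \<open>The left side is at most b^K, where b \<le> 2 \<beta> exp x exp (\<beta> / 2 - (1 +
  \<eta>) x); this is the origin of \<open>A\<close>. As b \<le> 1, the exponent \<open>K\<close>
  may be dropped.\<close>

lemma alpha_bound: "real (n choose K) * (1 - p) ^ (K choose 2) \<le> A * real n powr (- 3/4 * \<eta>)"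
proof -
  define b where "b = exp 1 * real n / real K * exp (ln (1 - p) * (real K - 1) / 2)"
  have K0: "0 < K" using K_bounds(4) by simp
  have "real (n choose K) * (1 - p) ^ (K choose 2) \<le> b ^ K"
    unfolding b_def power_mult_distrib using p_lt_1 n_pos K0
    by (subst power_choose_two_exp) (auto intro!: mult_right_mono binomial_le_exp_power)
  have b0: "0 \<le> b" by (simp add: b_def)
  have "b \<le> A * real n powr (- 3/4 * \<eta>)"
  proof -
    have LK: "(1 + \<eta>) * x \<le> L * K / 2" using K_bounds(1) L_pos by (simp add: field_simps)
    have e3: "exp 1 \<le> (3::real)" by (rule exp_le)
    have r0: "0 < x / L" using r_bounds by linarith
    have "exp 1 * real n / real K \<le> 3 * real n / (2 * (x / L))"
    proof (intro frac_le mult_right_mono e3)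
      have "2 * (x / L) \<le> 2 * (1 + \<eta>) * (x / L)" using eta r0 by (intro mult_right_mono) auto
      then show "2 * (x / L) \<le> real K" using K_bounds(1) by linarith
    qed (use r0 in auto)
    also have "\<dots> = 3/2 * real n * (L / x)" by simp
    also have "\<dots> \<le> 3/2 * real n * ((\<beta> * p) / (3/4))"
      using L_bounds(2) L_pos x_bounds h1 p_pos beta_gt_1 by (intro mult_left_mono frac_le) auto
    also have "\<dots> = 2 * \<beta> * exp x" by (simp add: np_exp[symmetric])
    finally have 1: "exp 1 * real n / real K \<le> 2 * \<beta> * exp x" .
    have "exp (ln (1 - p) * (real K - 1) / 2) = exp (L / 2 - L * K / 2)"
      by (simp add: L_def field_simps)
    also have "\<dots> \<le> exp (\<beta> / 2 - (1 + \<eta>) * x)"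
    proof -
      have "\<beta> * p \<le> \<beta> * 1" using beta_gt_1 p_lt_1 by (intro mult_left_mono) auto
      then show ?thesis using LK L_bounds(2) by simp
    qed
    finally have "b \<le> 2 * \<beta> * exp x * exp (\<beta> / 2 - (1 + \<eta>) * x)"
      unfolding b_def using 1 by (intro mult_mono) (use beta_gt_1 in auto)
    also have "\<dots> = A * exp (- \<eta> * x)"
      by (simp add: A_def algebra_simps exp_add exp_diff exp_minus inverse_eq_divide)
    also have "\<dots> \<le> A * exp (- \<eta> * (3/4 * l))"
      using x_bounds eta beta_gt_1 by (intro mult_left_mono) (auto simp: A_def)
    finally show ?thesis by (simp add: n_powr mult_ac)
  qed
  moreover have "A * real n powr (- 3/4 * \<eta>) \<le> 1"
    using h4 n_pos by (simp add: powr_minus field_simps)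
  ultimately have "b ^ K \<le> b" using b0 K0 by (intro power_decreasing[of 1 K b, simplified]) auto
  then show ?thesis using \<open>real (n choose K) * (1 - p) ^ (K choose 2) \<le> b ^ K\<close>
      \<open>b \<le> A * real n powr (- 3/4 * \<eta>)\<close> by linarith
qed

text \<open>The condition under which half of the transversals are good. Up to constants it compares
  l^3 / p^3 with n p / l^2, which is again a bound on n p^4.\<close>

lemma k_K_s: "2 * (k * k * t * K) \<le> s"
proof -
  have "2 * (real k * real k * real t * real K) \<le> 2 * ((2 * l / p) * (2 * l / p) * real t * (3 * l / p))"
    using k_bounds(3) K_bounds(3) p_pos h1 by (intro mult_left_mono mult_mono) auto
  also have "\<dots> = 24 * real t * l ^ 3 / p ^ 3" by (simp add: power_numeral_reduce power_divide field_simps)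
  also have "\<dots> \<le> \<eta> * real n * p / (2 * l\<^sup>2)"
  proof -
    have "48 * real t * l ^ 5 \<le> \<eta> * l ^ 4 * l ^ 5" using h6 h1 by (intro mult_right_mono) auto
    also have "\<dots> \<le> \<eta> * (real n * p ^ 4)" using np4 eta by (simp add: mult.assoc power_add[symmetric])
    finally show ?thesis using p_pos h1 by (simp add: divide_simps) (simp add: power_numeral_reduce algebra_simps)
  qed
  also have "\<dots> \<le> real s" by (rule s_bounds)
  finally have "real (2 * (k * k * t * K)) \<le> real s" by simp
  then show ?thesis by (simp only: of_nat_le_iff)
qed

lemma k_le_s: "k \<le> s"
proof -
  have "k * 1 \<le> k * (2 * k * t * K)" using k_bounds(4) K_bounds(4) t by (intro mult_le_mono2) (simp add: Suc_le_eq)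
  also have "\<dots> = 2 * (k * k * t * K)" by simp
  finally show ?thesis using k_K_s by linarith
qed

lemma s_le_n: "real s \<le> real n"
proof -
  have "\<eta> * real n * p / l\<^sup>2 \<le> 1 * real n * 1 / 1"
    using eta p_pos p_lt_1 h1 by (intro frac_le mult_mono) (auto simp: one_le_power)
  then show ?thesis using s_bounds(1) by linarith
qed

lemma beta_inverse: "1 / (1 - p) \<le> \<beta>"
  unfolding \<beta>_def using p_hi eps by (intro divide_left_mono) auto

section \<open>The overlap sum in Janson's inequality\<close>

lemma k_over_s: "real k / real s \<le> 4 * l ^ 3 / (\<eta> * (real n * p\<^sup>2))"
proof -
  have "real k / real s \<le> (2 * l / p) / (\<eta> * real n * p / (2 * l\<^sup>2))"
    using k_bounds(3) s_bounds(2) eta n_pos p_pos h1 by (intro frac_le) auto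
  also have "\<dots> = 4 * l ^ 3 / (\<eta> * (real n * p\<^sup>2))"
    by (simp add: power2_eq_square power3_eq_cube mult_ac)
  finally show ?thesis .
qed

text \<open>For bounded \<open>j\<close> the power of 1 / (1 - p) is bounded by a constant, and as k
  \<le> s the exponent of k / s may be lowered to 2.\<close>

lemma overlap_term_small:
  assumes j: "2 \<le> j" "j \<le> k" "j < \<Lambda>"
  shows "real (k choose j) / real s ^ j / (1 - p) ^ (j choose 2) \<le> \<beta> ^ (\<Lambda> * \<Lambda>) * (real k / real s)\<^sup>2"
proof -
  have "real (k choose j) \<le> real k ^ j"
    using binomial_le_pow[OF j(2)] by (metis of_nat_le_iff of_nat_power)
  then have "real (k choose j) / real s ^ j \<le> (real k / real s) ^ j"
    by (simp add: power_divide divide_right_mono)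
  also have "\<dots> \<le> (real k / real s)\<^sup>2"
    using k_le_s s_pos j(1) by (intro power_decreasing) auto
  finally have 1: "real (k choose j) / real s ^ j \<le> (real k / real s)\<^sup>2" .
  have "(1 / (1 - p)) ^ (j choose 2) \<le> \<beta> ^ (j choose 2)"
    using beta_inverse p_lt_1 by (intro power_mono) auto
  also have "\<dots> \<le> \<beta> ^ (\<Lambda> * \<Lambda>)"
  proof (rule power_increasing)
    have "j choose 2 \<le> j ^ 2" using j(1) by (rule binomial_le_pow)
    also have "\<dots> \<le> \<Lambda> * \<Lambda>" using j(3) by (simp add: power2_eq_square mult_le_mono)
    finally show "j choose 2 \<le> \<Lambda> * \<Lambda>" .
  qed (use beta_gt_1 in simp)
  finally have "(1 / (1 - p)) ^ (j choose 2) \<le> \<beta> ^ (\<Lambda> * \<Lambda>)" .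
  then have "real (k choose j) / real s ^ j * (1 / (1 - p)) ^ (j choose 2)
      \<le> (real k / real s)\<^sup>2 * \<beta> ^ (\<Lambda> * \<Lambda>)"
    using 1 p_lt_1 by (intro mult_mono) auto
  then show ?thesis by (simp add: power_one_over power_inverse mult.commute divide_inverse)
qed

text \<open>The \<open>j\<close>-th power of this base dominates the overlap term. For
  \<open>j\<close> near \<open>k\<close> the factor exp (L j / 2) may reach (n p)^(1 - \<eta>), but
  1 / s outweighs it; for small \<open>j\<close> that factor is bounded and k / s alone
  suffices.\<close>

lemma overlap_base:
  assumes j: "1 \<le> j" "j \<le> k"
  shows "exp 1 * real k / real j / real s * exp (L * (real j - 1) / 2) \<le> exp (- \<eta> / 4 * l)"
proof -
  define E where "E = exp (\<eta> / 4 * l)"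
  have E: "2 * exp 1 * l\<^sup>2 \<le> \<eta> * E" using h7 by (simp add: E_def n_powr mult.commute)
  have E0: "0 < E" by (simp add: E_def)
  have Lk: "L * real k / 2 \<le> (1 - \<eta>) * x"
    using k_bounds(1) L_pos by (simp add: field_simps)
  have Lj: "L * (real j - 1) / 2 \<le> L * real j / 2" using L_pos by (simp add: field_simps)
  \<comment> \<open>The cut is at j = k / n^(\<eta>/4). Above it two factors \<open>E\<close> are
    lost, one for k / j and one for the logarithms and 1 / \<eta>; together they are n^(\<eta>/2),
    against a gain of n^(3\<eta>/4).\<close>
  show ?thesis
  proof (cases "real k \<le> real j * E")
    case True
    then have kj: "real k / real j \<le> E" using j(1) by (simp add: field_simps)
    have sx: "1 / real s \<le> 2 * l\<^sup>2 / (\<eta> * exp x)"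
    proof -
      have "1 / real s \<le> 1 / (\<eta> * real n * p / (2 * l\<^sup>2))"
        using s_bounds(2) s_pos eta n_pos p_pos h1
        by (intro divide_left_mono mult_pos_pos divide_pos_pos) auto
      then show ?thesis by (simp add: np_exp[symmetric] mult.assoc)
    qed
    have ex: "exp (L * (real j - 1) / 2) \<le> exp ((1 - \<eta>) * x)"
    proof -
      have "L * real j / 2 \<le> L * real k / 2" using j(2) L_pos by simp
      then show ?thesis using Lk Lj by simp
    qed
    have "exp 1 * real k / real j / real s * exp (L * (real j - 1) / 2)
        = exp 1 * (real k / real j) * (1 / real s) * exp (L * (real j - 1) / 2)" by simp
    also have "\<dots> \<le> exp 1 * E * (2 * l\<^sup>2 / (\<eta> * exp x)) * exp ((1 - \<eta>) * x)"
      using kj sx ex E0 eta by (intro mult_mono) auto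
    also have "\<dots> = (2 * exp 1 * l\<^sup>2 / \<eta>) * E * exp (- \<eta> * x)"
      using eta by (simp add: left_diff_distrib exp_diff exp_minus field_simps)
    also have "\<dots> \<le> E * E * exp (- \<eta> * (3/4 * l))"
      using E eta E0 x_bounds(1) by (intro mult_mono) (auto simp: field_simps)
    also have "\<dots> = exp (- \<eta> / 4 * l)"
      by (simp add: E_def exp_add[symmetric] algebra_simps)
    finally show ?thesis .
  next
    case False
    have "L * real j / 2 * E \<le> 1 * E"
    proof -
      have "L * real j / 2 * E = (L / 2) * (real j * E)" by simp
      also have "\<dots> \<le> (L / 2) * real k" using False L_pos by (intro mult_left_mono) auto
      also have "\<dots> \<le> (1 - \<eta>) * x" using Lk by simp
      also have "\<dots> \<le> 1 * l" using eta x_bounds h1 by (intro mult_mono) auto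
      also have "\<dots> \<le> 2 * exp 1 * l\<^sup>2"
      proof -
        have "1 * l * 1 \<le> l * l * exp 1" using h1 by (intro mult_mono) auto
        then show ?thesis using h1 by (simp add: power2_eq_square mult_ac)
      qed
      also have "\<dots> \<le> \<eta> * E" by (rule E)
      also have "\<dots> \<le> 1 * E" using eta E0 by (intro mult_right_mono) auto
      finally show ?thesis .
    qed
    then have "L * real j / 2 \<le> 1" using E0 mult_le_cancel_right_pos by blast
    then have ex: "exp (L * (real j - 1) / 2) \<le> exp 1" using Lj by simp
    have ks: "real k / real s \<le> 4 * l ^ 3 / (\<eta> * exp (1/2 * l))"
    proof -
      have "4 * l ^ 3 / (\<eta> * (real n * p\<^sup>2)) \<le> 4 * l ^ 3 / (\<eta> * exp (1/2 * l))"
        using np2_ge eta h1 n_pos p_pos by (intro divide_left_mono mult_left_mono) auto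
      then show ?thesis using k_over_s by linarith
    qed
    have "exp 1 * real k / real j / real s * exp (L * (real j - 1) / 2)
        = exp 1 * (real k / real s) * (1 / real j) * exp (L * (real j - 1) / 2)" by simp
    also have "\<dots> \<le> exp 1 * (4 * l ^ 3 / (\<eta> * exp (1/2 * l))) * 1 * exp 1"
      using ks ex j(1) eta h1 by (intro mult_mono) auto
    also have "\<dots> = (4 * exp 2 * l ^ 3 / \<eta>) * exp (- (1/2 * l))"
      by (simp add: exp_minus field_simps flip: exp_add)
    also have "\<dots> \<le> exp (1/4 * l) * exp (- (1/2 * l))"
      using h8 eta by (intro mult_right_mono) (auto simp: field_simps n_powr)
    also have "\<dots> = exp (- 1/4 * l)" by (simp flip: exp_add)
    also have "\<dots> \<le> exp (- \<eta> / 4 * l)"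
    proof -
      have "\<eta> * l \<le> 1 * l" using eta h1 by (intro mult_right_mono) auto
      then show ?thesis by simp
    qed
    finally show ?thesis .
  qed
qed

text \<open>A base of at most n^(-\<eta>/4), raised to a power of at least \<Lambda> \<ge> 12 /
  \<eta>, gives n^(-3); this is the origin of the 12 in \<open>Lam\<close>.\<close>

lemma overlap_term_large:
  assumes j: "1 \<le> j" "j \<le> k" "\<Lambda> \<le> j"
  shows "real (k choose j) / real s ^ j / (1 - p) ^ (j choose 2) \<le> exp (- 3 * l)"
proof -
  have "real (k choose j) / real s ^ j / (1 - p) ^ (j choose 2)
      \<le> (exp 1 * real k / real j) ^ j / real s ^ j * exp (L * (real j - 1) / 2) ^ j"
  proof -
    have "1 / (1 - p) ^ (j choose 2) = exp (L * (real j - 1) / 2) ^ j"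
      using p_lt_1 by (simp add: power_choose_two_exp L_def exp_minus power_inverse inverse_eq_divide power_divide)
    moreover have "real (k choose j) / real s ^ j * (1 / (1 - p) ^ (j choose 2))
        \<le> (exp 1 * real k / real j) ^ j / real s ^ j * (1 / (1 - p) ^ (j choose 2))"
      using j k_bounds(4) p_lt_1 by (intro mult_right_mono divide_right_mono binomial_le_exp_power) auto
    ultimately show ?thesis by (simp only: divide_inverse mult_1_left)
  qed
  also have "\<dots> = (exp 1 * real k / real j / real s * exp (L * (real j - 1) / 2)) ^ j"
    by (simp add: power_divide power_mult_distrib)
  also have "\<dots> \<le> exp (- \<eta> / 4 * l) ^ j"
    using overlap_base[OF j(1,2)] by (intro power_mono) auto
  also have "\<dots> \<le> exp (- \<eta> / 4 * l) ^ \<Lambda>"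
    using j(3) eta h1 by (intro power_decreasing) auto
  also have "\<dots> = exp (- (\<eta> * real \<Lambda>) / 4 * l)" by (simp add: exp_of_nat_mult[symmetric] mult_ac)
  also have "\<dots> \<le> exp (- 3 * l)"
    using Lam h1 by (intro iffD2[OF exp_le_cancel_iff] mult_right_mono) auto
  finally show ?thesis .
qed

text \<open>At most \<open>\<Lambda>\<close> terms are a constant times (k/s)^2. The contributions
  n^(-3) add up to at most n^(-2), which is at most (k/s)^2 because k \<ge> 1 and s \<le> n; they
  account for the 1 in \<open>B\<close>.\<close>

lemma overlap_sum:
  "(\<Sum>j = 2..k. real (k choose j) / real s ^ j / (1 - p) ^ (j choose 2)) \<le> B * (real k / real s)\<^sup>2"
proof -
  define a where "a = \<beta> ^ (\<Lambda> * \<Lambda>) * (real k / real s)\<^sup>2"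
  have a0: "0 \<le> a" using beta_gt_1 by (simp add: a_def)
  have "(\<Sum>j = 2..k. real (k choose j) / real s ^ j / (1 - p) ^ (j choose 2))
      \<le> (\<Sum>j = 2..k. (if j < \<Lambda> then a else 0) + exp (- 3 * l))"
  proof (rule sum_mono)
    fix j assume j: "j \<in> {2..k}"
    show "real (k choose j) / real s ^ j / (1 - p) ^ (j choose 2) \<le> (if j < \<Lambda> then a else 0) + exp (- 3 * l)"
    proof (cases "j < \<Lambda>")
      case True
      then show ?thesis using overlap_term_small[of j] j exp_ge_zero[of "- 3 * l"]
        by (auto simp: a_def simp del: exp_ge_zero)
    next
      case False
      then show ?thesis using overlap_term_large[of j] j by auto
    qed
  qed
  also have "\<dots> = (\<Sum>j = 2..k. if j < \<Lambda> then a else 0) + real (k - 1) * exp (- 3 * l)"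
    by (simp add: sum.distrib)
  also have "(\<Sum>j = 2..k. if j < \<Lambda> then a else 0) \<le> real \<Lambda> * a"
  proof -
    have "card ({2..k} \<inter> {j. j < \<Lambda>}) \<le> card {..<\<Lambda>}" by (rule card_mono) auto
    then show ?thesis using a0 by (simp add: sum.If_cases mult_right_mono)
  qed
  also have "real (k - 1) * exp (- 3 * l) \<le> (real k / real s)\<^sup>2"
  proof -
    have e3: "exp (- 3 * l) = (1 / real n) ^ 3"
      using exp_of_nat_mult[of 3 "- l"] by (simp add: n_exp exp_minus inverse_eq_divide)
    have "real (k - 1) * exp (- 3 * l) \<le> real n * exp (- 3 * l)"
      using k_le_s s_le_n by (intro mult_right_mono) auto
    also have "\<dots> = (1 / real n)\<^sup>2"
      unfolding e3 using n_pos by (simp add: power2_eq_square power3_eq_cube)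
    also have "\<dots> \<le> (real k / real s)\<^sup>2"
      using k_bounds(4) s_pos s_le_n by (intro power_mono frac_le) auto
    finally show ?thesis .
  qed
  finally show ?thesis by (simp add: a_def B_def algebra_simps)
qed

text \<open>Janson's exponent is at least \<eta>^2 n l^3 / (128 B), hence at least (t + 2) n l by
  \<open>h5\<close>. Of this, t n l cancels the number of colouring families, and 2 n l covers both
  2^n and the target 1 / n.\<close>

lemma rich_bound:
  "2 ^ n * real n ^ (t * n) * exp (- (1 / (8 * (B * (real k / real s)\<^sup>2)))) \<le> 1 / real n"
proof -
  have B1: "1 \<le> B" using beta_gt_1 by (simp add: B_def)
  have ks0: "0 < real k / real s" using k_bounds(4) s_pos by simp
  have "(real k / real s)\<^sup>2 \<le> (4 * l ^ 3 / (\<eta> * (real n * p\<^sup>2)))\<^sup>2"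
    using k_over_s ks0 by (intro power_mono) auto
  also have "\<dots> = 16 * l ^ 6 / (\<eta>\<^sup>2 * (real n * (real n * p ^ 4)))"
    by (simp add: power_divide power_mult_distrib power2_eq_square power_mult[symmetric] power_numeral_reduce mult_ac)
  also have "\<dots> \<le> 16 * l ^ 6 / (\<eta>\<^sup>2 * (real n * l ^ 9))"
    using np4 h1 eta n_pos p_pos by (intro divide_left_mono mult_left_mono mult_pos_pos) auto
  also have "\<dots> = 16 / (\<eta>\<^sup>2 * (real n * l ^ 3))"
    using h1 by (simp add: power_numeral_reduce)
  finally have ks: "(real k / real s)\<^sup>2 \<le> 16 / (\<eta>\<^sup>2 * (real n * l ^ 3))" .
  have "(real t + 2) * real n * l \<le> 1 / (8 * (B * (16 / (\<eta>\<^sup>2 * (real n * l ^ 3)))))"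
  proof -
    have "128 * B * (real t + 2) * (real n * l) \<le> \<eta>\<^sup>2 * l\<^sup>2 * (real n * l)"
      using h5 h1 n_pos by (intro mult_right_mono) auto
    then show ?thesis using B1 eta h1 n_pos
      by (simp add: field_simps power2_eq_square power3_eq_cube)
  qed
  also have "\<dots> \<le> 1 / (8 * (B * (real k / real s)\<^sup>2))"
    using ks B1 k_bounds(4) s_pos eta n_pos h1
    by (intro divide_left_mono mult_left_mono mult_pos_pos) auto
  finally have e: "(real t + 2) * real n * l \<le> 1 / (8 * (B * (real k / real s)\<^sup>2))" .
  have "2 ^ n \<le> exp (1::real) ^ n" using exp_ge_add_one_self[of 1] by (intro power_mono) auto
  also have "\<dots> = exp (real n)" by (simp add: exp_of_nat_mult[symmetric])
  finally have two: "(2::real) ^ n \<le> exp (real n)" .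
  have nt: "real n ^ (t * n) = exp (real t * real n * l)"
    by (subst n_exp) (simp add: exp_of_nat_mult[symmetric])
  have "2 ^ n * real n ^ (t * n) * exp (- (1 / (8 * (B * (real k / real s)\<^sup>2))))
      \<le> exp (real n) * exp (real t * real n * l) * exp (- ((real t + 2) * real n * l))"
    unfolding nt using two e by (intro mult_mono) auto
  also have "\<dots> = exp (real n - 2 * (real n * l))"
    by (simp add: algebra_simps flip: exp_add)
  also have "\<dots> \<le> exp (- l)"
  proof -
    have "real n * 1 \<le> real n * l" "1 * l \<le> real n * l" using h1 n_pos by (intro mult_mono; simp)+
    then show ?thesis by simp
  qed
  also have "\<dots> = 1 / real n" unfolding n_exp by (simp add: exp_minus inverse_eq_divide)
  finally show ?thesis .
qed

section \<open>Palette size and comparison of the two parameters\<close>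

lemma palette_bound: "real K * real M \<le> (1 + 55 * \<eta>) * real n"
proof -
  have r0: "0 < x / L" using r_bounds by linarith
  have k0: "0 < real k" using k_bounds(4) by simp
  have eta2: "\<eta> * \<eta> \<le> 1/4 * \<eta>" using eta by (intro mult_right_mono) auto
  have Kk: "real K \<le> (1 + 6 * \<eta>) * real k"
  proof -
    have "real K \<le> (2 + 3 * \<eta>) * (x / L)" by (rule K_bounds)
    also have "\<dots> \<le> ((1 + 6 * \<eta>) * (2 - 3 * \<eta>)) * (x / L)"
      using r0 eta eta2 by (intro mult_right_mono) (auto simp: algebra_simps)
    also have "\<dots> = (1 + 6 * \<eta>) * ((2 - 3 * \<eta>) * (x / L))" by simp
    also have "\<dots> \<le> (1 + 6 * \<eta>) * real k" using k_bounds(2) eta by (intro mult_left_mono) auto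
    finally show ?thesis .
  qed
  have "real K * real (n div k) \<le> real K * (real n / real k)"
    by (intro mult_left_mono of_nat_div_le_of_nat) auto
  also have "\<dots> \<le> (1 + 6 * \<eta>) * real k * (real n / real k)"
    using Kk by (intro mult_right_mono) auto
  also have "\<dots> = (1 + 6 * \<eta>) * real n" using k0 by simp
  finally have 1: "real K * real (n div k) \<le> (1 + 6 * \<eta>) * real n" .
  have lp: "1 \<le> l / p" using h1 p_pos p_lt_1 by (simp add: field_simps)
  have "real K * real d \<le> (3 * l / p) * (16 * \<eta> * real n * p / l + 1)"
    using K_bounds(3) d_bounds(2) h1 p_pos by (intro mult_mono) auto
  also have "\<dots> = 48 * \<eta> * real n + 3 * (l / p)"
    using h1 p_pos by (simp add: field_simps)
  also have "\<dots> \<le> 48 * \<eta> * real n + 3 * (real t * (l / p)\<^sup>2)"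
  proof -
    have "1 * (l / p) * 1 \<le> real t * (l / p) * (l / p)"
      using lp t h1 p_pos by (intro mult_mono) auto
    moreover have "real t * (l / p) * (l / p) = real t * (l / p)\<^sup>2"
      by (simp only: power2_eq_square mult.assoc)
    ultimately show ?thesis by linarith
  qed
  finally have 2: "real K * real d \<le> 48 * \<eta> * real n + 3 * (real t * (l / p)\<^sup>2)" .
  have 3: "real K * (real t * real K) \<le> 9 * (real t * (l / p)\<^sup>2)"
  proof -
    have "real K * real K \<le> (3 * l / p) * (3 * l / p)"
      using K_bounds(3) h1 p_pos by (intro mult_mono) auto
    then have "real t * (real K * real K) \<le> real t * ((3 * l / p) * (3 * l / p))"
      by (intro mult_left_mono) auto
    then show ?thesis by (simp add: power2_eq_square mult_ac)
  qed
  have 4: "12 * (real t * (l / p)\<^sup>2) \<le> \<eta> * real n"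
  proof -
    have "12 * real t * l\<^sup>2 \<le> \<eta> * (real n * p\<^sup>2)"
      using h9 np2_ge eta by (smt (verit) mult_left_mono n_powr)
    then show ?thesis using p_pos by (simp add: power_divide field_simps)
  qed
  \<comment> \<open>The constant is 55 = 6 + 48 + 1: from the ratio K / k, from \<open>d\<close>,
    and from the terms of order t (l/p)^2, which are at most \<eta> n because n p^2 is
    large.\<close>
  have "real K * real M = real K * real (n div k) + real K * real d + real K * (real t * real K)"
    by (simp add: M_def algebra_simps)
  also have "\<dots> \<le> (1 + 55 * \<eta>) * real n" using 1 2 3 4 by (simp add: algebra_simps)
  finally show ?thesis .
qed

lemma M_le_n: "M \<le> n"
proof -
  have "16 * real M \<le> real K * real M" using K_bounds(4) by (intro mult_right_mono) auto
  also have "\<dots> \<le> (1 + 55 * \<eta>) * real n" by (rule palette_bound)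
  also have "\<dots> \<le> 16 * real n" using eta by (intro mult_right_mono) auto
  finally show ?thesis by simp
qed

lemma d_pos: "0 < d"
proof -
  have "0 < 16 * \<eta> * real n * p / l" using eta n_pos p_pos h1 by simp
  then show ?thesis using d_bounds(1) by linarith
qed

text \<open>Both tau and t chi lie between t n / K and t M, and these two bounds differ by a factor
  of at most 1 + 55 \<eta>.\<close>

lemma tau_chi_close:
  assumes G: "G \<subseteq> all_edges n" and "small_alpha n K G" "rich n t K k (k * s) G"
    "locally_sparse n (k * s) d G"
  shows "\<bar>real (tau t n G) - real t * real (chi n G)\<bar> \<le> 55 * real t * \<eta> * real (chi n G)"
proof -
  have "0 < k" "0 < K" "0 < t" using k_bounds(4) K_bounds(4) t by auto
  note b = tau_chi_bounds[OF assms \<open>0 < k\<close> d_pos \<open>0 < K\<close> \<open>0 < t\<close> M_def M_le_n]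
  define T X where "T = real (tau t n G)" and "X = real (chi n G)"
  have b': "T \<le> real t * real M" "X \<le> real M" "real t * real n \<le> T * real K" "real n \<le> X * real K"
    using b[THEN of_nat_mono, where 'a = real] by (simp_all add: T_def X_def)
  have K0: "0 < real K" using \<open>0 < K\<close> by simp
  have X0: "0 \<le> X" by (simp add: X_def)
  have "T * real K \<le> real t * (real K * real M)"
    using mult_right_mono[OF b'(1), of "real K"] by (simp add: mult_ac)
  also have "\<dots> \<le> real t * ((1 + 55 * \<eta>) * real n)"
    using palette_bound by (intro mult_left_mono) auto
  also have "\<dots> \<le> real t * ((1 + 55 * \<eta>) * (X * real K))"
    using b'(4) eta by (intro mult_left_mono) auto
  finally have "T * real K \<le> (real t * (1 + 55 * \<eta>) * X) * real K" by (simp add: mult_ac)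
  then have upper: "T \<le> real t * (1 + 55 * \<eta>) * X" using K0 by simp
  have "real t * X * real K = real t * (real K * X)" by simp
  also have "\<dots> \<le> real t * (real K * real M)"
    using b'(2) by (intro mult_left_mono) auto
  also have "\<dots> \<le> real t * ((1 + 55 * \<eta>) * real n)"
    using palette_bound by (intro mult_left_mono) auto
  also have "\<dots> = (1 + 55 * \<eta>) * (real t * real n)" by simp
  also have "\<dots> \<le> (1 + 55 * \<eta>) * (T * real K)" using b'(3) eta by (intro mult_left_mono) auto
  finally have "(real t * X) * real K \<le> ((1 + 55 * \<eta>) * T) * real K" by (simp add: mult_ac)
  then have lower: "real t * X \<le> (1 + 55 * \<eta>) * T" using K0 by simp
  \<comment> \<open>Multiply by 1 - 55 \<eta> and use (1 + y)(1 - y) \<le> 1. If that factor is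
    negative, the left side is nonpositive and the claim is trivial.\<close>
  have "real t * X * (1 - 55 * \<eta>) \<le> T"
  proof (cases "0 \<le> 1 - 55 * \<eta>")
    case True
    have "real t * X * (1 - 55 * \<eta>) \<le> (1 + 55 * \<eta>) * T * (1 - 55 * \<eta>)"
      using lower True by (intro mult_right_mono)
    also have "\<dots> = T * (1 - (55 * \<eta>)\<^sup>2)" by (simp add: power2_eq_square algebra_simps)
    also have "\<dots> \<le> T * 1" by (intro mult_left_mono) (auto simp: T_def)
    finally show ?thesis by simp
  next
    case False
    then have "real t * X * (1 - 55 * \<eta>) \<le> 0" using X0 by (intro mult_nonneg_nonpos) auto
    then show ?thesis by (simp add: T_def)
  qed
  then show ?thesis using upper unfolding T_def[symmetric] X_def[symmetric]
    by (simp add: abs_le_iff algebra_simps)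
qed

lemma prob_tau_chi:
  "1 - (A * real n powr (- 3/4 * \<eta>) + 3 / real n) \<le> measure_pmf.prob (gnp n p)
    {G. \<bar>real (tau t n G) - real t * real (chi n G)\<bar> \<le> 55 * real t * \<eta> * real (chi n G)}"
proof -
  let ?P = "measure_pmf.prob (gnp n p)"
  let ?good = "{G. \<bar>real (tau t n G) - real t * real (chi n G)\<bar> \<le> 55 * real t * \<eta> * real (chi n G)}"
  let ?B1 = "{G. \<not> small_alpha n K G}" and ?B2 = "{G. \<not> rich n t K k (k * s) G}"
    and ?B3 = "{G. \<not> locally_sparse n (k * s) d G}"
  have p: "0 \<le> p" "p \<le> 1" "p < 1" using p_pos p_lt_1 by auto
  have b1: "?P ?B1 \<le> A * real n powr (- 3/4 * \<eta>)"
    using prob_not_small_alpha[OF p(1,2)] alpha_bound by (rule order_trans)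
  have b2: "?P ?B2 \<le> 1 / real n"
    using prob_not_rich[OF p(1,3) k_bounds(4) _ k_K_s overlap_sum] s_pos rich_bound
    by (meson of_nat_0_less_iff order_trans)
  have b3: "?P ?B3 \<le> 2 / real n"
    using prob_not_locally_sparse[OF p(1,2) m_d] sparse_bound by (rule order_trans)
  have "?P {G. G \<notin> ?good} \<le> ?P {G. G \<in> ?B1 \<union> ?B2 \<union> ?B3}"
    unfolding gnp_eq_rsub using tau_chi_close by (intro prob_mono_rsub) blast
  also have "\<dots> \<le> ?P (?B1 \<union> ?B2) + ?P ?B3"
    unfolding Collect_mem_eq by (rule measure_Un_le) auto
  also have "?P (?B1 \<union> ?B2) \<le> ?P ?B1 + ?P ?B2"
    by (rule measure_Un_le) auto
  finally have "?P {G. G \<notin> ?good} \<le> A * real n powr (- 3/4 * \<eta>) + 3 / real n"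
    using b1 b2 b3 by simp
  moreover have "?P {G. G \<notin> ?good} = 1 - ?P ?good"
    using measure_pmf.prob_compl[of ?good "gnp n p"] by (simp add: Compl_eq_Diff_UNIV[symmetric] Compl_eq)
  ultimately show ?thesis by linarith
qed

end

theorem theorem3:
  fixes t :: nat and \<epsilon> :: real
  assumes "t \<ge> 3" and "\<epsilon> < 1"
  shows "\<exists>C0::real. \<forall>C \<ge> C0. \<forall>p :: nat \<Rightarrow> real.
     (\<forall>\<^sub>F n in sequentially.
        C * real n powr (-1/4) * ln (real n) powr (9/4) \<le> p n \<and> p n < \<epsilon>) \<longrightarrow>
     (\<forall>\<delta>>0. (\<lambda>n. measure_pmf.prob (gnp n (p n))
        {E. \<bar>real (tau t n E) - real t * real (chi n E)\<bar> \<le> \<delta> * real (chi n E)})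
        \<longlonglongrightarrow> 1)"
proof (intro exI[of _ 1] allI impI)
  \<comment> \<open>The threshold 1 works because the spare factor l^2 in n p^4 \<ge> l^9 does what
    a large \<open>C\<close> would do.\<close>
  fix C :: real and p :: "nat \<Rightarrow> real" and \<delta> :: real
  assume C: "1 \<le> C" and \<delta>: "0 < \<delta>"
    and p: "\<forall>\<^sub>F n in sequentially. C * real n powr (-1/4) * ln (real n) powr (9/4) \<le> p n \<and> p n < \<epsilon>"
  \<comment> \<open>\<open>\<eta>\<close> is the relative slack of the construction; the loss 55 t
    \<eta> in \<open>tau_chi_close\<close> must be at most \<delta>.\<close>
  define \<eta> where "\<eta> = min (1/4) (\<delta> / (55 * real t))"
  have \<eta>: "0 < \<eta>" "\<eta> \<le> 1/4" "55 * real t * \<eta> \<le> \<delta>"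
  proof -
    show "0 < \<eta>" "\<eta> \<le> 1/4" using \<delta> assms(1) by (auto simp: \<eta>_def)
    have "\<eta> \<le> \<delta> / (55 * real t)" by (simp add: \<eta>_def)
    then show "55 * real t * \<eta> \<le> \<delta>" using assms(1) by (simp add: field_simps)
  qed
  define \<Lambda> where "\<Lambda> = nat \<lceil>12 / \<eta>\<rceil>"
  have "12 / \<eta> \<le> real \<Lambda>" unfolding \<Lambda>_def by linarith
  then have Lam: "12 \<le> \<eta> * real \<Lambda>" using \<eta>(1) by (simp add: field_simps)
  define \<beta> where "\<beta> = 1 / (1 - \<epsilon>)"
  define A where "A = 2 * \<beta> * exp (\<beta> / 2)"
  define B where "B = real \<Lambda> * \<beta> ^ (\<Lambda> * \<Lambda>) + 1"
  have "0 < \<eta>\<^sup>2" using \<eta>(1) by simp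
  have "\<forall>\<^sub>F n in sequentially. 1 \<le> ln (real n)" by real_asymp
  moreover have "\<forall>\<^sub>F n in sequentially. 8 * \<beta> \<le> 3 * ln (real n) * \<eta>" using \<eta>(1) by real_asymp
  moreover have "\<forall>\<^sub>F n in sequentially. 2 * (ln (real n))\<^sup>2 \<le> \<eta> * real n powr (3/4)"
    using \<eta>(1) by real_asymp
  moreover have "\<forall>\<^sub>F n in sequentially. A \<le> real n powr (3/4 * \<eta>)" using \<eta>(1) by real_asymp
  moreover have "\<forall>\<^sub>F n in sequentially. 128 * B * (real t + 2) \<le> \<eta>\<^sup>2 * (ln (real n))\<^sup>2"
    using \<open>0 < \<eta>\<^sup>2\<close> by real_asymp
  moreover have "\<forall>\<^sub>F n in sequentially. 48 * real t \<le> \<eta> * (ln (real n)) ^ 4"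
    using \<eta>(1) by real_asymp
  moreover have "\<forall>\<^sub>F n in sequentially. 2 * exp 1 * (ln (real n))\<^sup>2 \<le> \<eta> * real n powr (\<eta> / 4)"
    using \<eta>(1) by real_asymp
  moreover have "\<forall>\<^sub>F n in sequentially. 4 * exp 2 * (ln (real n)) ^ 3 \<le> \<eta> * real n powr (1/4)"
    using \<eta>(1) by real_asymp
  moreover have "\<forall>\<^sub>F n in sequentially. 12 * real t * (ln (real n))\<^sup>2 \<le> \<eta> * real n powr (1/2)"
    using \<eta>(1) by real_asymp
  ultimately have bound: "\<forall>\<^sub>F n in sequentially. 1 - (A * real n powr (- 3/4 * \<eta>) + 3 / real n)
      \<le> measure_pmf.prob (gnp n (p n)) {E. \<bar>real (tau t n E) - real t * real (chi n E)\<bar> \<le> \<delta> * real (chi n E)}"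
    using p
  proof eventually_elim
    case (elim n)
    have "1 * (real n powr (-1/4) * ln (real n) powr (9/4)) \<le> C * (real n powr (-1/4) * ln (real n) powr (9/4))"
      using C by (intro mult_right_mono) auto
    then have "real n powr (-1/4) * ln (real n) powr (9/4) \<le> p n" using elim(10) by (simp add: mult.assoc)
    then interpret regime n t \<Lambda> "p n" \<epsilon> \<eta> "ln (real n)" \<beta> A B
      using elim assms \<eta> Lam unfolding \<beta>_def A_def B_def by unfold_locales auto
    have "{E. \<bar>real (tau t n E) - real t * real (chi n E)\<bar> \<le> 55 * real t * \<eta> * real (chi n E)}
        \<subseteq> {E. \<bar>real (tau t n E) - real t * real (chi n E)\<bar> \<le> \<delta> * real (chi n E)}"
      using \<eta>(3) by (auto intro: order_trans[OF _ mult_right_mono])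
    then show ?case
      by (intro order_trans[OF prob_tau_chi measure_pmf.finite_measure_mono]) auto
  qed
  have "(\<lambda>n. real n powr (- (3/4 * \<eta>))) \<longlonglongrightarrow> 0"
    using \<eta>(1) by (intro tendsto_neg_powr filterlim_real_sequentially) auto
  moreover have "(\<lambda>n. 3 / real n) \<longlonglongrightarrow> 0" by real_asymp
  ultimately have "(\<lambda>n. 1 - (A * real n powr (- (3/4 * \<eta>)) + 3 / real n)) \<longlonglongrightarrow> 1 - (A * 0 + 0)"
    by (intro tendsto_intros)
  then have lim: "(\<lambda>n. 1 - (A * real n powr (- 3/4 * \<eta>) + 3 / real n)) \<longlonglongrightarrow> 1"
    by simp
  show "(\<lambda>n. measure_pmf.prob (gnp n (p n))
      {E. \<bar>real (tau t n E) - real t * real (chi n E)\<bar> \<le> \<delta> * real (chi n E)}) \<longlonglongrightarrow> 1"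
    by (rule tendsto_sandwich[OF bound _ lim tendsto_const]) simp
qed

end
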